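(* Consider the closed-loop system described in the context, with the gain-scheduling controller $u[k]=K[k]\tilde y[k]$, $K[k]=\alpha_1[k]K_1+\alpha_2[k]K_2$, where $K_1,K_2\in\mathbb{R}^{n_u\times n_y}$ are given, $\Delta_1:=\Delta_{\min}$, $\Delta_2:=\Delta_{\max}$, and $$\alpha_1[k]:=\frac{\Delta_2-E[k]}{\Delta_2-\Delta_1},\qquad \alpha_2[k]:=\frac{E[k]-\Delta_1}{\Delta_2-\Delta_1}.$$ Let $\sigma\in(0,1]$ and $\gamma>0$. For $\bm j=(j_1,\dots,j_{n_y})\in\mathcal{J}_{n_y}$ let $\Lambda_{\bm j}:=\mathrm{diag}(\lambda_1 j_1,\dots,\lambda_{n_y}j_{n_y})$. Suppose there exist, for $p=1,2$ and $\bm j\in\mathcal{J}_{n_y}$, positive definite matrices $P_p\in\mathbb{R}^{n_x\times n_x}$, symmetric matrices with nonnegative entries $$\begin{bmatrix} L_{p,\bm j} & N_{p,\bm j}\\ N_{p,\bm j}^{\top} & M_{p,\bm j}\end{bmatrix}\in\mathbb{R}^{2n_y\times 2n_y}\quad(L_{p,\bm j},M_{p,\bm j},N_{p,\bm j}\in\mathbb{R}^{n_y\times n_y}),$$ and symmetric matrices $Z_{p,\bm j}\in\mathbb{R}^{n_y\times n_y}$, such that for every $p,q\in\{1,2\}$ and every $\bm j\in\mathcal{J}_{n_y}$, $$\begin{bmatrix}\Gamma_{p,q,\bm j} & \Phi_{p,q,\bm j}\\ \Phi_{p,q,\bm j}^{\top} & \Xi_{q,\bm j}\end{bmatrix}\succ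 0,$$ where $N^+_{q,\bm j}:=N_{q,\bm j}+N_{q,\bm j}^{\top}$, $N^-_{q,\bm j}:=N_{q,\bm j}-N_{q,\bm j}^{\top}$, $$R_{q,\bm j}:=\begin{bmatrix} L_{q,\bm j}+M_{q,\bm j}+N^+_{q,\bm j} & L_{q,\bm j}-M_{q,\bm j}-N^-_{q,\bm j}\\ (L_{q,\bm j}-M_{q,\bm j}-N^-_{q,\bm j})^{\top} & L_{q,\bm j}+M_{q,\bm j}+Z_{q,\bm j}\end{bmatrix},$$ $\Gamma_{p,q,\bm j}:=\mathrm{diag}(\sigma^2P_p,\ \gamma^2 I_{n_w},\ N^+_{q,\bm j}+Z_{q,\bm j})$, $\Xi_{q,\bm j}:=\mathrm{diag}(P_q,\ I_{n_z},\ R_{q,\bm j})$, and $$\Phi_{p,q,\bm j}:=\begin{bmatrix} A+BK_pC & BK_pD & BK_p\\ F&0&0\\ \Delta_p\Lambda_{\bm j}C & \Delta_p\Lambda_{\bm j}D & 0\\ 0&0&I_{n_y}\end{bmatrix}^{\top}\Xi_{q,\bm j}.$$ Then: (i) the closed-loop system is practically stable with an ultimate bound of the form $\eta=\rho\cdot\max_{i=1,\dots,n_y}\big((\Delta_{\max}\lambda_i+1)\bar w\|D\|_\infty+\delta_i\big)$ for some $\rho\ge 0$, i.e., for every $\bar w\ge0$, $\|w[k]\|_\infty\le\bar w$ for all $k\in\mathbb{Z}_+$ implies $\limsup_{k\to\infty}\|x[k]\|\le\eta$; (ii) the closed-loop system has decay rate $\sigma$; and (iii) its $\ell^2$-gain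 from $w$ to $z$ is less than or equal to $\gamma$.
   Context: Plant (discrete time, $k\in\mathbb{Z}_+$): $x[k+1]=Ax[k]+Bu[k]$, $y[k]=Cx[k]+Dw[k]$, $z[k]=Fx[k]$, with $x[k]\in\mathbb{R}^{n_x}$, $u[k]\in\mathbb{R}^{n_u}$, $y[k]=[y_1[k],\dots,y_{n_y}[k]]^\top\in\mathbb{R}^{n_y}$, noise $w[k]\in\mathbb{R}^{n_w}$, performance output $z[k]\in\mathbb{R}^{n_z}$. Event-triggered try-once-discard protocol: fix $\Delta_{\max}>\Delta_{\min}\ge0$, $\lambda_i>0$, $\delta_i\ge0$ ($i=1,\dots,n_y$). Let $l^i_k$ be the latest time $\le k$ at which $y_i$ was transmitted (with some stored initial released value). At each $k$, compute $e_i'[k]:=y_i[l^i_{k-1}]-y_i[k]$ and $E_i':=\frac{|e_i'[k]|-\delta_i}{\lambda_i|y_i[k]|}$ (convention: $\alpha/0=+\infty$ for $\alpha>0$, $\beta/0=-\infty$ for $\beta\le0$). Rule: if $\max_iE_i'<\Delta_{\min}$, nothing is transmitted; if $\max_iE_i'\ge\Delta_{\max}$, all $y_i[k]$ with $E_i'\ge\Delta_{\max}$ are transmitted; otherwise a single $y_i[k]$ achieving $E_i'=\max_iE_i'$ is transmitted (any one if ties). If $y_i[k]$ is transmitted then $l^i_k=k$, otherwise $l^i_k=l^i_{k-1}$. Define $E[k]:=\Delta_{\min}$ if $\max_iE_i'<\Delta_{\min}$, $E[k]:=\Delta_{\max}$ if $\max_iE_i'\ge\Delta_{\max}$, and $E[k]:=\max_iE_i'$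 otherwise. Let $\tilde y[k]:=[y_1[l^1_k],\dots,y_{n_y}[l^{n_y}_k]]^\top$; the controller is $u[k]=K(E[k])\tilde y[k]$. Notation: $\|\cdot\|$ Euclidean norm; $\|v\|_\infty=\max_i|v_i|$ and $\|D\|_\infty$ is the induced matrix norm; $\mathcal{J}_n:=\{(j_1,\dots,j_n): j_p\in\{1,-1\}\}$; $\succ0$ means symmetric positive definite; $\ell^2$ is the space of square-summable sequences on $\mathbb{Z}_+$ with $\|v\|_{\ell^2}=(\sum_k v[k]^\top v[k])^{1/2}$. Definitions: the closed-loop system is practically stable if for every $\bar w\ge0$ there is $\eta\ge0$ with $\|w[k]\|_\infty\le\bar w\ \forall k\Rightarrow\limsup_{k\to\infty}\|x[k]\|\le\eta$. It has decay rate $\sigma$ if there is $M\ge1$ such that whenever $w[k]=0$ for all $k$ and $\delta_i=0$ for all $i$, $\|x[k]\|\le M\sigma^k\|x[0]\|$ for all $k\in\mathbb{Z}_+$. Its $\ell^2$-gain (for $w\in\ell^2$) is at most $\gamma$ if, whenever $x[0]=0$ and $\delta_i=0$ for all $i$, $z\in\ell^2$ and $\|z\|_{\ell^2}\le\gamma\|w\|_{\ell^2}$. *)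

theory Defs
  imports Complex_Main "Jordan_Normal_Form.Matrix" "HOL-Library.Extended_Real"
    "HOL-Library.Liminf_Limsup"
begin

definition pd_mat :: "nat \<Rightarrow> real mat \<Rightarrow> bool" where
  "pd_mat n M \<longleftrightarrow> M \<in> carrier_mat n n \<and> transpose_mat M = M \<and>
     (\<forall>v \<in> carrier_vec n. v \<noteq> 0\<^sub>v n \<longrightarrow> v \<bullet> (M *\<^sub>v v) > 0)"

definition sym_mat :: "nat \<Rightarrow> real mat \<Rightarrow> bool" where
  "sym_mat n M \<longleftrightarrow> M \<in> carrier_mat n n \<and> transpose_mat M = M"

definition nonneg_entries :: "real mat \<Rightarrow> bool" where
  "nonneg_entries M \<longleftrightarrow> (\<forall>i < dim_row M. \<forall>k < dim_col M. M $$ (i, k) \<ge> 0)"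

definition diag3 :: "real mat \<Rightarrow> real mat \<Rightarrow> real mat \<Rightarrow> real mat" where
  "diag3 A1 A2 A3 =
     four_block_mat A1 (0\<^sub>m (dim_row A1) (dim_col A2 + dim_col A3))
       (0\<^sub>m (dim_row A2 + dim_row A3) (dim_col A1))
       (four_block_mat A2 (0\<^sub>m (dim_row A2) (dim_col A3)) (0\<^sub>m (dim_row A3) (dim_col A2)) A3)"

definition Lam_mat :: "nat \<Rightarrow> (nat \<Rightarrow> real) \<Rightarrow> real vec \<Rightarrow> real mat" where
  "Lam_mat ny lam j = mat ny ny (\<lambda>(i, k). if i = k then lam i * j $ i else 0)"

definition J_set :: "nat \<Rightarrow> real vec set" where
  "J_set n = {j \<in> carrier_vec n. \<forall>i < n. j $ i = 1 \<or> j $ i = -1}"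

definition enorm :: "real vec \<Rightarrow> real" where
  "enorm v = sqrt (v \<bullet> v)"

definition inorm :: "real vec \<Rightarrow> real" where
  "inorm v = Max (insert 0 {\<bar>v $ i\<bar> | i. i < dim_vec v})"

definition inorm_mat :: "real mat \<Rightarrow> real" where
  "inorm_mat M = Sup {inorm (M *\<^sub>v v) | v. v \<in> carrier_vec (dim_col M) \<and> inorm v \<le> 1}"

text \<open>E'_i with the convention alpha/0 = +infinity (alpha > 0), beta/0 = -infinity (beta <= 0).\<close>
definition Eprime :: "real \<Rightarrow> real \<Rightarrow> real \<Rightarrow> real \<Rightarrow> ereal" where
  "Eprime lam del e y =
     (if lam * \<bar>y\<bar> = 0 then (if \<bar>e\<bar> - del > 0 then \<infinity> else -\<infinity>)
      else ereal ((\<bar>e\<bar> - del) / (lam * \<bar>y\<bar>)))"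

definition Ksched :: "real \<Rightarrow> real \<Rightarrow> real mat \<Rightarrow> real mat \<Rightarrow> real \<Rightarrow> real mat" where
  "Ksched Dmin Dmax K1 K2 E =
     ((Dmax - E) / (Dmax - Dmin)) \<cdot>\<^sub>m K1 + ((E - Dmin) / (Dmax - Dmin)) \<cdot>\<^sub>m K2"

text \<open>cl_traj ... h0 x w yt: x is a state trajectory, w a noise sequence and yt the sequence
  of held (latest transmitted) output values tilde-y, with initial stored released values h0,
  generated by the closed loop (for some admissible resolution of ties).\<close>
definition cl_traj ::
  "nat \<Rightarrow> nat \<Rightarrow> nat \<Rightarrow> nat \<Rightarrow> nat \<Rightarrow>
   real mat \<Rightarrow> real mat \<Rightarrow> real mat \<Rightarrow> real mat \<Rightarrow> real mat \<Rightarrow> real mat \<Rightarrow>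
   real \<Rightarrow> real \<Rightarrow> (nat \<Rightarrow> real) \<Rightarrow> (nat \<Rightarrow> real) \<Rightarrow>
   real vec \<Rightarrow> (nat \<Rightarrow> real vec) \<Rightarrow> (nat \<Rightarrow> real vec) \<Rightarrow> (nat \<Rightarrow> real vec) \<Rightarrow> bool" where
  "cl_traj nx nu ny nw nz A B C D K1 K2 Dmin Dmax lam del h0 x w yt \<longleftrightarrow>
     h0 \<in> carrier_vec ny \<and>
     (\<forall>k. x k \<in> carrier_vec nx \<and> w k \<in> carrier_vec nw \<and> yt k \<in> carrier_vec ny) \<and>
     (\<forall>k. let y = C *\<^sub>v x k + D *\<^sub>v w k;
             hprev = (if k = 0 then h0 else yt (k - 1));
             Ep = (\<lambda>i. Eprime (lam i) (del i) (hprev $ i - y $ i) (y $ i));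
             mx = Max (Ep ` {..<ny})
         in \<exists>T E.
              T \<subseteq> {..<ny} \<and>
              (mx < ereal Dmin \<longrightarrow> T = {} \<and> E = Dmin) \<and>
              (mx \<ge> ereal Dmax \<longrightarrow> T = {i \<in> {..<ny}. Ep i \<ge> ereal Dmax} \<and> E = Dmax) \<and>
              (ereal Dmin \<le> mx \<and> mx < ereal Dmax \<longrightarrow>
                 (\<exists>i0 < ny. Ep i0 = mx \<and> T = {i0}) \<and> mx = ereal E) \<and>
              (\<forall>i < ny. yt k $ i = (if i \<in> T then y $ i else hprev $ i)) \<and>
              x (Suc k) = A *\<^sub>v x k + B *\<^sub>v (Ksched Dmin Dmax K1 K2 E *\<^sub>v yt k))"


definition hcat :: "real mat \<Rightarrow> real mat \<Rightarrow> real mat" where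
  "hcat X Y = mat (dim_row X) (dim_col X + dim_col Y)
     (\<lambda>(i, k). if k < dim_col X then X $$ (i, k) else Y $$ (i, k - dim_col X))"

definition R_mat :: "real mat \<Rightarrow> real mat \<Rightarrow> real mat \<Rightarrow> real mat \<Rightarrow> real mat" where
  "R_mat L M N Z =
     (let Np = N + transpose_mat N; Nm = N - transpose_mat N in
      four_block_mat (L + M + Np) (L - M - Nm) (transpose_mat (L - M - Nm)) (L + M + Z))"

text \<open>The block matrix [Gamma, Phi; Phi^T, Xi] for given p, q, j, where
  Pp = P_p, Pq = P_q, Kp = K_p, Dp = Delta_p, Lj = Lambda_j and L, M, N, Z are the
  matrices with index (q, j).\<close>
definition LMI_mat ::
  "nat \<Rightarrow> nat \<Rightarrow> nat \<Rightarrow> nat \<Rightarrow> nat \<Rightarrow>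
   real mat \<Rightarrow> real mat \<Rightarrow> real mat \<Rightarrow> real mat \<Rightarrow> real mat \<Rightarrow>
   real \<Rightarrow> real \<Rightarrow> real mat \<Rightarrow> real mat \<Rightarrow> real mat \<Rightarrow> real \<Rightarrow> real mat \<Rightarrow>
   real mat \<Rightarrow> real mat \<Rightarrow> real mat \<Rightarrow> real mat \<Rightarrow> real mat" where
  "LMI_mat nx nu ny nw nz A B C D F sigma gamma Pp Pq Kp Dp Lj L M N Z =
     (let Np = N + transpose_mat N;
          Gamma = diag3 ((sigma^2) \<cdot>\<^sub>m Pp) ((gamma^2) \<cdot>\<^sub>m 1\<^sub>m nw) (Np + Z);
          Xi = diag3 Pq (1\<^sub>m nz) (R_mat L M N Z);
          G = (hcat (hcat (A + B * Kp * C) (B * Kp * D)) (B * Kp)) @\<^sub>r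
              (hcat (hcat F (0\<^sub>m nz nw)) (0\<^sub>m nz ny)) @\<^sub>r
              (hcat (hcat (Dp \<cdot>\<^sub>m (Lj * C)) (Dp \<cdot>\<^sub>m (Lj * D))) (0\<^sub>m ny ny)) @\<^sub>r
              (hcat (hcat (0\<^sub>m ny nx) (0\<^sub>m ny nw)) (1\<^sub>m ny));
          Phi = transpose_mat G * Xi
      in four_block_mat Gamma Phi (transpose_mat Phi) Xi)"

end

(*
  With e[k] = ytilde[k] - y[k], the protocol guarantees the sector bound
  |e_i[k]| <= E[k] lambda_i |y_i[k]| + delta_i. The matrix inequality is affine in p, so a convex
  combination of the cases p = 1, 2 with weights alpha[k], evaluated at (xi, -G xi) where G is the
  corresponding combination of the block rows of Phi, acts as a Schur complement. The R-blocks
  contribute a quadratic form with nonnegative coefficients in (f + e, f - e), where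
  f = E Lambda_j y and j is the sign pattern of y; this is nonnegative when delta = 0. Combining
  the cases q = 1, 2 with the weights alpha[k+1] gives the strict dissipation inequality
    V[k+1] + |z|^2 + epsilon |x|^2 <= sigma^2 V[k] + gamma^2 |w|^2,  V = x^T (alpha_1 P_1 + alpha_2 P_2) x,
  from which decay rate and l2-gain follow. For practical stability the inequality is applied
  with w = 0 and output C x, after clipping the transmission error to the sector; the clipped-off
  part is bounded by max_i ((Delta_max lambda_i + 1) wbar ||D|| + delta_i) and enters as an
  additive input disturbance of a geometrically contracting V.
*)
theory Submission
  imports Defs
begin


section \<open>Quadratic forms\<close>

text \<open>Both values of p are tested at one and the same vector, built from the interpolated
  successor. The cross terms then add up to -2 times each quadratic term, and exactly one negative
  copy survives; testing each p at its own successor would control only the two extreme gains. This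
  relies on the R-blocks carrying the index (q, j) and not p, while P does not depend on j, so V is
  unaffected by changes of the sign pattern. The same epsilon must serve all times, although sign
  pattern and weights vary: hence compactness of the unit sphere together with finiteness of the set
  of sign patterns. Since sigma may equal 1, this epsilon is the only source of contraction for the
  ultimate bound. That bound cannot be read off the term gamma^2 |w|^2: it may depend on the noise
  only through wbar ||D||, hence must vanish for D = 0 and delta = 0. As noise enters only through
  y, it can be counted as transmission error instead. The sector condition may then fail, and
  entrywise nonnegative multipliers give no information about f + e or f - e with negative entries;
  clipping restores the signs.\<close>

lemma scalar_prod_nonneg_real: "(v :: real vec) \<bullet> v \<ge> 0"
  by (auto simp: scalar_prod_def intro!: sum_nonneg)

lemma vec_index_sq_le:
  fixes v :: "real vec"
  assumes "v \<in> carrier_vec n" "i < n"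
  shows "(v $ i)\<^sup>2 \<le> v \<bullet> v"
proof -
  have "(v $ i)\<^sup>2 \<le> (\<Sum>k\<in>{0..<n}. (v $ k)\<^sup>2)"
    by (rule member_le_sum) (use assms in auto)
  then show ?thesis using assms by (simp add: scalar_prod_def power2_eq_square)
qed

lemma scalar_prod_self_pos:
  fixes v :: "real vec"
  assumes "v \<in> carrier_vec n" "v \<noteq> 0\<^sub>v n"
  shows "v \<bullet> v > 0"
proof -
  obtain i where "i < n" "v $ i \<noteq> 0"
    using assms by (metis carrier_vecD eq_vecI index_zero_vec)
  then show ?thesis
    using vec_index_sq_le[OF assms(1), of i] by (smt (verit) zero_less_power2)
qed

lemma bilinear_sum:
  fixes u v :: "real vec"
  assumes "u \<in> carrier_vec n" "v \<in> carrier_vec m" "M \<in> carrier_mat n m"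
  shows "u \<bullet> (M *\<^sub>v v) = (\<Sum>i<n. \<Sum>k<m. u $ i * M $$ (i, k) * v $ k)"
  using assms
  by (auto simp: scalar_prod_def sum_distrib_left atLeast0LessThan mult.assoc intro!: sum.cong)

text \<open>The sum of all absolute entries is a crude constant, but only the existence of some
  constant matters later. Each summand is estimated by 2|ab| <= a^2 + b^2.\<close>

lemma quad_form_le:
  fixes M :: "real mat"
  assumes "M \<in> carrier_mat n n"
  shows "\<exists>c\<ge>0. \<forall>v\<in>carrier_vec n. v \<bullet> (M *\<^sub>v v) \<le> c * (v \<bullet> v)"
proof (intro exI conjI ballI)
  define c where "c = (\<Sum>i<n. \<Sum>k<n. \<bar>M $$ (i, k)\<bar>)"
  show "0 \<le> c" unfolding c_def by (intro sum_nonneg) auto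
  fix v :: "real vec" assume v: "v \<in> carrier_vec n"
  have "v $ i * M $$ (i, k) * v $ k \<le> \<bar>M $$ (i, k)\<bar> * (v \<bullet> v)" if "i < n" "k < n" for i k
  proof -
    have "\<bar>v $ i * v $ k\<bar> \<le> v \<bullet> v"
      using vec_index_sq_le[OF v that(1)] vec_index_sq_le[OF v that(2)]
        sum_squares_bound[of "\<bar>v $ i\<bar>" "\<bar>v $ k\<bar>"]
      unfolding abs_mult power2_abs by linarith
    then have "\<bar>M $$ (i, k)\<bar> * \<bar>v $ i * v $ k\<bar> \<le> \<bar>M $$ (i, k)\<bar> * (v \<bullet> v)"
      by (intro mult_left_mono) auto
    moreover have "v $ i * M $$ (i, k) * v $ k \<le> \<bar>M $$ (i, k)\<bar> * \<bar>v $ i * v $ k\<bar>"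
      using abs_ge_self[of "v $ i * M $$ (i, k) * v $ k"] by (simp add: abs_mult ac_simps)
    ultimately show ?thesis by linarith
  qed
  then show "v \<bullet> (M *\<^sub>v v) \<le> c * (v \<bullet> v)"
    unfolding bilinear_sum[OF v v assms] c_def sum_distrib_right
    by (intro sum_mono) auto
qed

text \<open>The squared length of \<open>M *\<^sub>v v\<close> is the quadratic form of the Gram
  matrix of \<open>M\<close>.\<close>

lemma mult_mat_vec_sq_le:
  fixes M :: "real mat"
  assumes "M \<in> carrier_mat n m"
  shows "\<exists>c\<ge>0. \<forall>v\<in>carrier_vec m. (M *\<^sub>v v) \<bullet> (M *\<^sub>v v) \<le> c * (v \<bullet> v)"
proof -
  have "transpose_mat M * M \<in> carrier_mat m m" using assms by auto
  from quad_form_le[OF this] obtain c where c: "c \<ge> 0"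
    "\<forall>v\<in>carrier_vec m. v \<bullet> ((transpose_mat M * M) *\<^sub>v v) \<le> c * (v \<bullet> v)" by blast
  have "v \<bullet> ((transpose_mat M * M) *\<^sub>v v) = (M *\<^sub>v v) \<bullet> (M *\<^sub>v v)" if v: "v \<in> carrier_vec m" for v
  proof -
    have "(M *\<^sub>v v) \<bullet> (M *\<^sub>v v) = (transpose_mat M *\<^sub>v (M *\<^sub>v v)) \<bullet> v"
      by (rule transpose_vec_mult_scalar[symmetric, of _ n m]) (use assms v in auto)
    also have "\<dots> = v \<bullet> (transpose_mat M *\<^sub>v (M *\<^sub>v v))"
      by (rule comm_scalar_prod[of _ m]) (use assms v in auto)
    finally show ?thesis using assms v by (simp add: assoc_mult_mat_vec[of _ m n _ m])
  qed
  then show ?thesis using c by auto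
qed

section \<open>Compactness of the unit sphere and coercivity of positive definite forms\<close>

text \<open>Bolzano-Weierstrass by induction on the coordinates: a monotone subsequence handles the
  new coordinate, and refining the subsequence does not disturb the convergence of the earlier
  ones.\<close>

lemma bounded_seqs_common_subseq:
  fixes f :: "nat \<Rightarrow> nat \<Rightarrow> real"
  assumes "\<And>i. i < n \<Longrightarrow> Bseq (\<lambda>m. f m i)"
  shows "\<exists>r. strict_mono r \<and> (\<forall>i<n. convergent (\<lambda>m. f (r m) i))"
  using assms
proof (induction n)
  case 0
  then show ?case by (auto intro!: exI[of _ id] simp: strict_mono_def)
next
  case (Suc n)
  then obtain r where r: "strict_mono r" "\<forall>i<n. convergent (\<lambda>m. f (r m) i)" by auto
  obtain s where s: "strict_mono s" "monoseq (\<lambda>m. f (r (s m)) n)"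
    using seq_monosub[of "\<lambda>m. f (r m) n"] by auto
  have "Bseq (\<lambda>m. f ((r \<circ> s) m) n)"
    using Bseq_subseq[OF Suc.prems[of n], of "r \<circ> s"] by (simp add: comp_def)
  then have "convergent (\<lambda>m. f (r (s m)) n)"
    using s by (intro Bseq_monoseq_convergent) (auto simp: comp_def)
  moreover have "convergent (\<lambda>m. f (r (s m)) i)" if "i < n" for i
    using convergent_subseq_convergent[OF r(2)[rule_format, OF that] s(1)] by (simp add: comp_def)
  ultimately show ?case
    using r s by (intro exI[of _ "r \<circ> s"]) (auto simp: less_Suc_eq strict_mono_def)
qed

text \<open>If no margin existed, unit vectors with form below 1/(m+1) would accumulate at a unit
  vector on which the form is at most 0, against positive definiteness.\<close>

lemma pd_mat_coercive:
  assumes "pd_mat n M"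
  shows "\<exists>\<epsilon>>0. \<forall>v\<in>carrier_vec n. \<epsilon> * (v \<bullet> v) \<le> v \<bullet> (M *\<^sub>v v)"
proof (rule ccontr)
  assume neg: "\<not> ?thesis"
  have M: "M \<in> carrier_mat n n" using assms by (simp add: pd_mat_def)
  have "\<exists>v\<in>carrier_vec n. v \<bullet> v = 1 \<and> v \<bullet> (M *\<^sub>v v) < 1 / Suc m" for m :: nat
  proof -
    have "1 / real (Suc m) > 0" by simp
    then obtain v where v: "v \<in> carrier_vec n" and lt: "v \<bullet> (M *\<^sub>v v) < 1 / Suc m * (v \<bullet> v)"
      using neg by (meson not_le)
    have "v \<noteq> 0\<^sub>v n" using lt M by auto
    then have pos: "v \<bullet> v > 0" using scalar_prod_self_pos v by blast
    define t where "t = 1 / sqrt (v \<bullet> v)"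
    have t: "t * t * (v \<bullet> v) = 1" "t > 0" using pos by (auto simp: t_def field_simps)
    have tt: "(t \<cdot>\<^sub>v v) \<bullet> (M *\<^sub>v (t \<cdot>\<^sub>v v)) = t * t * (v \<bullet> (M *\<^sub>v v))"
      using v M by (simp add: mult_mat_vec[of _ n n])
    have "t * t * (v \<bullet> (M *\<^sub>v v)) < t * t * (1 / Suc m * (v \<bullet> v))"
      using lt t by (intro mult_strict_left_mono) auto
    also have "\<dots> = 1 / Suc m * (t * t * (v \<bullet> v))" by (simp only: ac_simps)
    also have "\<dots> = 1 / Suc m" by (simp only: t mult_1_right)
    finally show ?thesis
      using t v tt by (intro bexI[of _ "t \<cdot>\<^sub>v v"]) (auto simp: mult.assoc)
  qed
  then obtain f where f: "\<And>m. f m \<in> carrier_vec n" "\<And>m. f m \<bullet> f m = 1"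
    "\<And>m :: nat. f m \<bullet> (M *\<^sub>v f m) < 1 / Suc m" by metis
  have "Bseq (\<lambda>m. f m $ i)" if "i < n" for i
  proof (rule BseqI'[of _ 1])
    show "norm (f m $ i) \<le> 1" for m
      using vec_index_sq_le[OF f(1) that, of m] f(2)[of m] by (simp add: abs_square_le_1)
  qed
  from bounded_seqs_common_subseq[of n "\<lambda>m i. f m $ i", OF this]
  obtain r where r: "strict_mono r" and conv: "\<forall>i<n. convergent (\<lambda>m. f (r m) $ i)" by auto
  define l where "l = vec n (\<lambda>i. lim (\<lambda>m. f (r m) $ i))"
  have l: "l \<in> carrier_vec n" by (simp add: l_def)
  have lim: "(\<lambda>m. f (r m) $ i) \<longlonglongrightarrow> l $ i" if "i < n" for i
    using conv that by (simp add: l_def convergent_LIMSEQ_iff)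
  have "(\<lambda>m. f (r m) \<bullet> f (r m)) \<longlonglongrightarrow> l \<bullet> l"
    unfolding scalar_prod_def carrier_vecD[OF f(1)] carrier_vecD[OF l]
    by (intro tendsto_sum tendsto_mult lim) auto
  then have "l \<bullet> l = 1" using f(2) by (simp add: LIMSEQ_const_iff)
  then have "l \<noteq> 0\<^sub>v n" by auto
  then have pos: "l \<bullet> (M *\<^sub>v l) > 0" using assms l by (simp add: pd_mat_def)
  have "(\<lambda>m. f (r m) \<bullet> (M *\<^sub>v f (r m))) \<longlonglongrightarrow> l \<bullet> (M *\<^sub>v l)"
    unfolding bilinear_sum[OF f(1) f(1) M] bilinear_sum[OF l l M]
    by (intro tendsto_sum tendsto_mult tendsto_const lim) auto
  moreover have "(\<lambda>m. 1 / real (Suc (r m))) \<longlonglongrightarrow> 0"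
    using LIMSEQ_subseq_LIMSEQ[OF lim_1_over_n[THEN LIMSEQ_Suc] r] by (simp add: comp_def)
  ultimately have "l \<bullet> (M *\<^sub>v l) \<le> 0"
    by (rule LIMSEQ_le) (intro exI[of _ 0] allI impI less_imp_le f)
  then show False using pos by simp
qed

text \<open>Nonnegativity of the form at t u - v, divided by t, bounds the two cross terms together.
  A small t makes the factor on u close to 1 at the price of a large factor on v.\<close>

lemma quad_form_young:
  assumes "pd_mat n M" "u \<in> carrier_vec n" "v \<in> carrier_vec n" "t > 0"
  shows "(u + v) \<bullet> (M *\<^sub>v (u + v)) \<le>
    (1 + t) * (u \<bullet> (M *\<^sub>v u)) + (1 + 1 / t) * (v \<bullet> (M *\<^sub>v v))"
proof -
  have M: "M \<in> carrier_mat n n" using assms by (simp add: pd_mat_def)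
  define z where "z = t \<cdot>\<^sub>v u - v"
  have z: "z \<in> carrier_vec n" using assms by (simp add: z_def)
  have "z \<bullet> (M *\<^sub>v z) \<ge> 0"
    using assms(1) z by (cases "z = 0\<^sub>v n") (auto simp: pd_mat_def less_imp_le)
  moreover have "z \<bullet> (M *\<^sub>v z) = t * t * (u \<bullet> (M *\<^sub>v u)) - t * (u \<bullet> (M *\<^sub>v v))
      - t * (v \<bullet> (M *\<^sub>v u)) + v \<bullet> (M *\<^sub>v v)"
    using assms M unfolding z_def
    by (simp add: mult_minus_distrib_mat_vec[of _ n n] mult_mat_vec[of _ n n]
        minus_scalar_prod_distrib[of _ n] scalar_prod_minus_distrib[of _ n] algebra_simps)
  moreover have "(u + v) \<bullet> (M *\<^sub>v (u + v)) = u \<bullet> (M *\<^sub>v u) + u \<bullet> (M *\<^sub>v v)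
      + v \<bullet> (M *\<^sub>v u) + v \<bullet> (M *\<^sub>v v)"
    using assms M
    by (simp add: mult_add_distrib_mat_vec[of _ n n]
        add_scalar_prod_distrib[of _ n] scalar_prod_add_distrib[of _ n])
  ultimately show ?thesis using \<open>t > 0\<close> by (simp add: field_simps)
qed

section \<open>Block matrices\<close>

text \<open>Block rows built by \<open>hcat\<close> nest to the left, whereas the vectors for
  \<open>diag3\<close> nest to the right; this law passes between the two.\<close>

lemma append_vec_assoc:
  "(u @\<^sub>v v) @\<^sub>v w = u @\<^sub>v (v @\<^sub>v w)"
  by (intro eq_vecI) (auto simp: index_append_vec)

lemma smult_mat_mult_vec:
  assumes "M \<in> carrier_mat n m" "v \<in> carrier_vec m"
  shows "(k \<cdot>\<^sub>m M) *\<^sub>v v = k \<cdot>\<^sub>v (M *\<^sub>v v)"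
  using assms by (intro eq_vecI) (auto simp: smult_scalar_prod_distrib[of _ m])

lemma hcat_carrier[simp, intro]:
  "X \<in> carrier_mat n m1 \<Longrightarrow> Y \<in> carrier_mat n m2 \<Longrightarrow> hcat X Y \<in> carrier_mat n (m1 + m2)"
  by (auto simp: hcat_def)

lemma hcat_mult_vec:
  assumes "X \<in> carrier_mat n m1" "Y \<in> carrier_mat n m2" "u \<in> carrier_vec m1" "v \<in> carrier_vec m2"
  shows "hcat X Y *\<^sub>v (u @\<^sub>v v) = X *\<^sub>v u + Y *\<^sub>v v"
proof (rule eq_vecI)
  fix i assume "i < dim_vec (X *\<^sub>v u + Y *\<^sub>v v)"
  then have i: "i < n" using assms by simp
  have "row (hcat X Y) i = row X i @\<^sub>v row Y i"
    using assms i by (intro eq_vecI) (auto simp: hcat_def)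
  then show "(hcat X Y *\<^sub>v (u @\<^sub>v v)) $ i = (X *\<^sub>v u + Y *\<^sub>v v) $ i"
    using assms i by (simp add: scalar_prod_append[of _ m1 _ m2] hcat_def)
qed (use assms in \<open>auto simp: hcat_def\<close>)

lemma diag3_carrier[simp, intro]:
  "A1 \<in> carrier_mat n1 n1 \<Longrightarrow> A2 \<in> carrier_mat n2 n2 \<Longrightarrow> A3 \<in> carrier_mat n3 n3 \<Longrightarrow>
    diag3 A1 A2 A3 \<in> carrier_mat (n1 + (n2 + n3)) (n1 + (n2 + n3))"
  unfolding diag3_def by (intro four_block_carrier_mat) auto

lemma diag3_mult_vec:
  assumes "A1 \<in> carrier_mat n1 n1" "A2 \<in> carrier_mat n2 n2" "A3 \<in> carrier_mat n3 n3"
    "u \<in> carrier_vec n1" "v \<in> carrier_vec n2" "w \<in> carrier_vec n3"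
  shows "diag3 A1 A2 A3 *\<^sub>v (u @\<^sub>v (v @\<^sub>v w)) = (A1 *\<^sub>v u) @\<^sub>v ((A2 *\<^sub>v v) @\<^sub>v (A3 *\<^sub>v w))"
proof -
  have "four_block_mat A2 (0\<^sub>m n2 n3) (0\<^sub>m n3 n2) A3 \<in> carrier_mat (n2 + n3) (n2 + n3)"
    by (intro four_block_carrier_mat) (use assms in auto)
  then show ?thesis
    using assms unfolding diag3_def
    by (simp add: mult_mat_vec_split[of _ n1 _ "n2 + n3"] mult_mat_vec_split[of _ n2 _ n3])
qed

lemma R_mat_carrier[simp, intro]:
  assumes "L \<in> carrier_mat n n" "M \<in> carrier_mat n n" "N \<in> carrier_mat n n" "Z \<in> carrier_mat n n"
  shows "R_mat L M N Z \<in> carrier_mat (n + n) (n + n)"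
  unfolding R_mat_def Let_def by (intro four_block_carrier_mat) (use assms in auto)

section \<open>Entrywise nonnegative multipliers and the expanded matrix inequality\<close>

lemma quad_form_nonneg:
  fixes M :: "real mat"
  assumes "M \<in> carrier_mat n m" "u \<in> carrier_vec n" "v \<in> carrier_vec m"
    "\<And>i k. i < n \<Longrightarrow> k < m \<Longrightarrow> M $$ (i, k) \<ge> 0"
    "\<And>i. i < n \<Longrightarrow> u $ i \<ge> 0" "\<And>i. i < m \<Longrightarrow> v $ i \<ge> 0"
  shows "u \<bullet> (M *\<^sub>v v) \<ge> 0"
  unfolding bilinear_sum[OF assms(2,3,1)] by (intro sum_nonneg mult_nonneg_nonneg assms) auto

lemma transpose_bilinear:
  fixes M :: "real mat"
  assumes "M \<in> carrier_mat n m" "u \<in> carrier_vec n" "v \<in> carrier_vec m"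
  shows "v \<bullet> (transpose_mat M *\<^sub>v u) = u \<bullet> (M *\<^sub>v v)"
  using transpose_vec_mult_scalar[OF assms(1,3,2)] assms
  by (subst comm_scalar_prod[of _ m]) auto

text \<open>This is where the shape of \<open>R_mat\<close> comes from. Put T = [I, I; I, -I], so
  that T maps (f, e) to (f + e, f - e). The congruence of [L, N; N^T, M] by T is exactly R with N +
  N^T + Z subtracted from its last block. The matrix Z cancels; it only shifts weight between the
  last blocks of Gamma and R.\<close>

lemma sector_block_identity:
  fixes L M N Z :: "real mat"
  assumes "L \<in> carrier_mat n n" "M \<in> carrier_mat n n" "N \<in> carrier_mat n n" "Z \<in> carrier_mat n n"
    and sym: "transpose_mat L = L" "transpose_mat M = M"
    and fe: "f \<in> carrier_vec n" "e \<in> carrier_vec n"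
  shows "(f @\<^sub>v e) \<bullet> (R_mat L M N Z *\<^sub>v (f @\<^sub>v e)) - e \<bullet> ((N + transpose_mat N + Z) *\<^sub>v e) =
    (f + e) \<bullet> (L *\<^sub>v (f + e)) + (f - e) \<bullet> (M *\<^sub>v (f - e)) + 2 * ((f + e) \<bullet> (N *\<^sub>v (f - e)))"
proof -
  note c = assms(1-4) fe
  have L: "e \<bullet> (L *\<^sub>v f) = f \<bullet> (L *\<^sub>v e)" using transpose_bilinear[of L n n f e] c sym by simp
  have M: "e \<bullet> (M *\<^sub>v f) = f \<bullet> (M *\<^sub>v e)" using transpose_bilinear[of M n n f e] c sym by simp
  have N: "u \<bullet> (transpose_mat N *\<^sub>v v) = v \<bullet> (N *\<^sub>v u)"
    if "u \<in> carrier_vec n" "v \<in> carrier_vec n" for u v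
    using transpose_bilinear[of N n n v u] c that by simp
  let ?T = "L - M - (N - transpose_mat N)"
  have T: "?T \<in> carrier_mat n n" using c by auto
  have "e \<bullet> (transpose_mat ?T *\<^sub>v f) = f \<bullet> (?T *\<^sub>v e)" by (rule transpose_bilinear[OF T]) (use c in auto)
  then have "(f @\<^sub>v e) \<bullet> (R_mat L M N Z *\<^sub>v (f @\<^sub>v e)) =
      f \<bullet> ((L + M + (N + transpose_mat N)) *\<^sub>v f) + 2 * (f \<bullet> (?T *\<^sub>v e)) + e \<bullet> ((L + M + Z) *\<^sub>v e)"
    unfolding R_mat_def Let_def using c T
    by (subst four_block_mat_mult_vec[of _ n n _ n _ n])
      (auto simp: scalar_prod_append[of _ n _ n] scalar_prod_add_distrib[of _ n] mult_mat_vec_carrier[of _ n n])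
  moreover have "?T *\<^sub>v e = L *\<^sub>v e - M *\<^sub>v e - (N *\<^sub>v e - transpose_mat N *\<^sub>v e)"
  proof -
    have "?T *\<^sub>v e = (L - M) *\<^sub>v e - (N - transpose_mat N) *\<^sub>v e"
      by (rule minus_mult_distrib_mat_vec[of _ n n]) (use c in auto)
    also have "(L - M) *\<^sub>v e = L *\<^sub>v e - M *\<^sub>v e"
      by (rule minus_mult_distrib_mat_vec[of _ n n]) (use c in auto)
    also have "(N - transpose_mat N) *\<^sub>v e = N *\<^sub>v e - transpose_mat N *\<^sub>v e"
      by (rule minus_mult_distrib_mat_vec[of _ n n]) (use c in auto)
    finally show ?thesis .
  qed
  ultimately show ?thesis
    using c by (simp add: add_mult_distrib_mat_vec[of _ n n] minus_mult_distrib_mat_vec[of _ n n]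
        mult_add_distrib_mat_vec[of _ n n] mult_minus_distrib_mat_vec[of _ n n]
        add_scalar_prod_distrib[of _ n] scalar_prod_add_distrib[of _ n]
        minus_scalar_prod_distrib[of _ n] scalar_prod_minus_distrib[of _ n] N L M)
qed

text \<open>The second half (a, b, f, g) of the test vector is left free instead of being tied to
  the first half by G. All dependence on p then sits in \<open>Pp\<close>, \<open>K\<close> and
  \<open>\<Delta>\<close>, each of which occurs affinely, so different p can be compared at a fixed
  vector.\<close>

lemma LMI_mat_quad_form:
  assumes dims: "A \<in> carrier_mat nx nx" "B \<in> carrier_mat nx nu" "C \<in> carrier_mat ny nx"
      "D \<in> carrier_mat ny nw" "F \<in> carrier_mat nz nx" "K \<in> carrier_mat nu ny"
      "Pp \<in> carrier_mat nx nx" "Pq \<in> carrier_mat nx nx" "\<Lambda> \<in> carrier_mat ny ny"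
      "L \<in> carrier_mat ny ny" "M \<in> carrier_mat ny ny" "N \<in> carrier_mat ny ny" "Z \<in> carrier_mat ny ny"
    and vecs: "x \<in> carrier_vec nx" "w \<in> carrier_vec nw" "e \<in> carrier_vec ny"
      "a \<in> carrier_vec nx" "b \<in> carrier_vec nz" "f \<in> carrier_vec ny" "g \<in> carrier_vec ny"
  shows "((x @\<^sub>v (w @\<^sub>v e)) @\<^sub>v (a @\<^sub>v (b @\<^sub>v (f @\<^sub>v g)))) \<bullet>
      (LMI_mat nx nu ny nw nz A B C D F \<sigma> \<gamma> Pp Pq K \<Delta> \<Lambda> L M N Z *\<^sub>v
        ((x @\<^sub>v (w @\<^sub>v e)) @\<^sub>v (a @\<^sub>v (b @\<^sub>v (f @\<^sub>v g))))) =
    \<sigma>\<^sup>2 * (x \<bullet> (Pp *\<^sub>v x)) + \<gamma>\<^sup>2 * (w \<bullet> w) + e \<bullet> ((N + transpose_mat N + Z) *\<^sub>v e)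
    + 2 * ((A *\<^sub>v x + B *\<^sub>v (K *\<^sub>v (C *\<^sub>v x + D *\<^sub>v w + e))) \<bullet> (Pq *\<^sub>v a) + (F *\<^sub>v x) \<bullet> b
      + ((\<Delta> \<cdot>\<^sub>v (\<Lambda> *\<^sub>v (C *\<^sub>v x + D *\<^sub>v w))) @\<^sub>v e) \<bullet> (R_mat L M N Z *\<^sub>v (f @\<^sub>v g)))
    + a \<bullet> (Pq *\<^sub>v a) + b \<bullet> b + (f @\<^sub>v g) \<bullet> (R_mat L M N Z *\<^sub>v (f @\<^sub>v g))"
proof -
  note c = dims vecs
  let ?R = "R_mat L M N Z"
  define G1 where "G1 = hcat (hcat (A + B * K * C) (B * K * D)) (B * K)"
  define G2 where "G2 = hcat (hcat F (0\<^sub>m nz nw)) (0\<^sub>m nz ny)"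
  define G3 where "G3 = hcat (hcat (\<Delta> \<cdot>\<^sub>m (\<Lambda> * C)) (\<Delta> \<cdot>\<^sub>m (\<Lambda> * D))) (0\<^sub>m ny ny)"
  define G4 where "G4 = hcat (hcat (0\<^sub>m ny nx) (0\<^sub>m ny nw)) (1\<^sub>m ny :: real mat)"
  define G where "G = G1 @\<^sub>r G2 @\<^sub>r G3 @\<^sub>r G4"
  define \<Xi> where "\<Xi> = diag3 Pq (1\<^sub>m nz) ?R"
  define \<Gamma> where "\<Gamma> = diag3 (\<sigma>\<^sup>2 \<cdot>\<^sub>m Pp) (\<gamma>\<^sup>2 \<cdot>\<^sub>m 1\<^sub>m nw) (N + transpose_mat N + Z)"
  define \<xi> where "\<xi> = x @\<^sub>v (w @\<^sub>v e)"
  define \<zeta> where "\<zeta> = a @\<^sub>v (b @\<^sub>v (f @\<^sub>v g))"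
  define m where "m = nx + (nw + ny)"
  define l where "l = nx + (nz + (ny + ny))"
  have G14: "G1 \<in> carrier_mat nx m" "G2 \<in> carrier_mat nz m" "G3 \<in> carrier_mat ny m" "G4 \<in> carrier_mat ny m"
    unfolding G1_def G2_def G3_def G4_def m_def add.assoc[symmetric] using c by auto
  then have G: "G \<in> carrier_mat l m" unfolding G_def l_def by auto
  have \<Xi>: "\<Xi> \<in> carrier_mat l l" unfolding \<Xi>_def l_def using c by auto
  have \<Gamma>: "\<Gamma> \<in> carrier_mat m m" unfolding \<Gamma>_def m_def using c by auto
  have \<xi>: "\<xi> \<in> carrier_vec m" unfolding \<xi>_def m_def using c by auto
  have \<zeta>: "\<zeta> \<in> carrier_vec l" unfolding \<zeta>_def l_def using c by auto
  have \<xi>': "\<xi> = (x @\<^sub>v w) @\<^sub>v e" by (simp add: \<xi>_def append_vec_assoc)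
  let ?y = "C *\<^sub>v x + D *\<^sub>v w"
  have G1\<xi>: "G1 *\<^sub>v \<xi> = A *\<^sub>v x + B *\<^sub>v (K *\<^sub>v (?y + e))"
  proof -
    have "G1 *\<^sub>v \<xi> = (A + B * K * C) *\<^sub>v x + (B * K * D) *\<^sub>v w + (B * K) *\<^sub>v e"
      unfolding G1_def \<xi>' using c
      by (subst hcat_mult_vec[of _ nx "nx + nw" _ ny]; (subst hcat_mult_vec[of _ nx nx _ nw])?; auto)
    also have "(A + B * K * C) *\<^sub>v x = A *\<^sub>v x + B *\<^sub>v (K *\<^sub>v (C *\<^sub>v x))"
      using c by (subst add_mult_distrib_mat_vec[of _ nx nx])
        (auto simp: assoc_mult_mat_vec[of _ nx nu _ nx] assoc_mult_mat_vec[of _ nu ny _ nx])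
    also have "(B * K * D) *\<^sub>v w = B *\<^sub>v (K *\<^sub>v (D *\<^sub>v w))"
      using c by (auto simp: assoc_mult_mat_vec[of _ nx nu _ nw] assoc_mult_mat_vec[of _ nu ny _ nw])
    also have "(B * K) *\<^sub>v e = B *\<^sub>v (K *\<^sub>v e)"
      using c by (auto simp: assoc_mult_mat_vec[of _ nx nu _ ny])
    finally show ?thesis
      using c by (simp add: mult_add_distrib_mat_vec[of _ nx nu] mult_add_distrib_mat_vec[of _ nu ny]
          assoc_add_vec[of _ nx])
  qed
  have G2\<xi>: "G2 *\<^sub>v \<xi> = F *\<^sub>v x"
    unfolding G2_def \<xi>' using c
    by (subst hcat_mult_vec[of _ nz "nx + nw" _ ny]; (subst hcat_mult_vec[of _ nz nx _ nw])?; auto)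
  have G3\<xi>: "G3 *\<^sub>v \<xi> = \<Delta> \<cdot>\<^sub>v (\<Lambda> *\<^sub>v ?y)"
  proof -
    have "G3 *\<^sub>v \<xi> = (\<Delta> \<cdot>\<^sub>m (\<Lambda> * C)) *\<^sub>v x + (\<Delta> \<cdot>\<^sub>m (\<Lambda> * D)) *\<^sub>v w"
      unfolding G3_def \<xi>' using c
      by (subst hcat_mult_vec[of _ ny "nx + nw" _ ny]; (subst hcat_mult_vec[of _ ny nx _ nw])?; auto)
    also have "(\<Delta> \<cdot>\<^sub>m (\<Lambda> * C)) *\<^sub>v x = \<Delta> \<cdot>\<^sub>v (\<Lambda> *\<^sub>v (C *\<^sub>v x))"
      using c by (simp add: smult_mat_mult_vec[of _ ny nx] assoc_mult_mat_vec[of _ ny ny _ nx])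
    also have "(\<Delta> \<cdot>\<^sub>m (\<Lambda> * D)) *\<^sub>v w = \<Delta> \<cdot>\<^sub>v (\<Lambda> *\<^sub>v (D *\<^sub>v w))"
      using c by (simp add: smult_mat_mult_vec[of _ ny nw] assoc_mult_mat_vec[of _ ny ny _ nw])
    finally show ?thesis
      using c by (simp add: mult_add_distrib_mat_vec[of _ ny ny] smult_add_distrib_vec[of _ ny])
  qed
  have G4\<xi>: "G4 *\<^sub>v \<xi> = e"
    unfolding G4_def \<xi>' using c
    by (subst hcat_mult_vec[of _ ny "nx + nw" _ ny]; (subst hcat_mult_vec[of _ ny nx _ nw])?; auto)
  have G\<xi>: "G *\<^sub>v \<xi> = (A *\<^sub>v x + B *\<^sub>v (K *\<^sub>v (?y + e))) @\<^sub>v (F *\<^sub>v x) @\<^sub>v (\<Delta> \<cdot>\<^sub>v (\<Lambda> *\<^sub>v ?y)) @\<^sub>v e"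
    unfolding G_def
    by (subst mat_mult_append[OF G14(1) _ \<xi>], use G14 in auto)
      (subst mat_mult_append[OF G14(2) _ \<xi>], use G14 in auto,
        subst mat_mult_append[OF G14(3) _ \<xi>], use G14 in \<open>auto simp: G1\<xi> G2\<xi> G3\<xi> G4\<xi>\<close>)
  have \<Xi>\<zeta>: "\<Xi> *\<^sub>v \<zeta> = (Pq *\<^sub>v a) @\<^sub>v (b @\<^sub>v (?R *\<^sub>v (f @\<^sub>v g)))"
    unfolding \<Xi>_def \<zeta>_def using c by (subst diag3_mult_vec[of _ nx _ nz _ "ny + ny"]) auto
  have \<Gamma>\<xi>: "\<Gamma> *\<^sub>v \<xi> = (\<sigma>\<^sup>2 \<cdot>\<^sub>v (Pp *\<^sub>v x)) @\<^sub>v ((\<gamma>\<^sup>2 \<cdot>\<^sub>v w) @\<^sub>v ((N + transpose_mat N + Z) *\<^sub>v e))"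
    unfolding \<Gamma>_def \<xi>_def using c
    by (subst diag3_mult_vec[of _ nx _ nw _ ny])
      (auto simp: smult_mat_mult_vec[of _ nx nx] smult_mat_mult_vec[of _ nw nw])
  let ?\<Phi> = "transpose_mat G * \<Xi>"
  have \<Phi>: "?\<Phi> \<in> carrier_mat m l" using G \<Xi> by auto
  \<comment> \<open>Moving the transpose to the other side leaves only
    \<open>G *\<^sub>v \<xi>\<close>, already computed block by block, paired with
    \<open>\<Xi> *\<^sub>v \<zeta>\<close>.\<close>
  have "\<xi> \<bullet> (?\<Phi> *\<^sub>v \<zeta>) = \<xi> \<bullet> (transpose_mat G *\<^sub>v (\<Xi> *\<^sub>v \<zeta>))"
    using G \<Xi> \<zeta> by (simp add: assoc_mult_mat_vec[of _ m l _ l])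
  also have "\<dots> = (\<Xi> *\<^sub>v \<zeta>) \<bullet> (G *\<^sub>v \<xi>)"
    using G \<Xi> \<zeta> \<xi> by (intro transpose_bilinear) auto
  also have "\<dots> = (G *\<^sub>v \<xi>) \<bullet> (\<Xi> *\<^sub>v \<zeta>)"
    using G \<Xi> \<zeta> \<xi> by (intro comm_scalar_prod[of _ l]) auto
  finally have cross: "\<xi> \<bullet> (?\<Phi> *\<^sub>v \<zeta>) = (G *\<^sub>v \<xi>) \<bullet> (\<Xi> *\<^sub>v \<zeta>)" .
  have cross': "\<zeta> \<bullet> (transpose_mat ?\<Phi> *\<^sub>v \<xi>) = (G *\<^sub>v \<xi>) \<bullet> (\<Xi> *\<^sub>v \<zeta>)"
    using transpose_bilinear[OF \<Phi> \<xi> \<zeta>] cross by simp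
  have Rfg: "?R *\<^sub>v (f @\<^sub>v g) \<in> carrier_vec (ny + ny)"
    using c by (intro mult_mat_vec_carrier[OF R_mat_carrier]) auto
  have LMI: "LMI_mat nx nu ny nw nz A B C D F \<sigma> \<gamma> Pp Pq K \<Delta> \<Lambda> L M N Z =
      four_block_mat \<Gamma> ?\<Phi> (transpose_mat ?\<Phi>) \<Xi>"
    by (simp add: LMI_mat_def Let_def G_def G1_def G2_def G3_def G4_def \<Gamma>_def \<Xi>_def)
  have "(\<xi> @\<^sub>v \<zeta>) \<bullet> (four_block_mat \<Gamma> ?\<Phi> (transpose_mat ?\<Phi>) \<Xi> *\<^sub>v (\<xi> @\<^sub>v \<zeta>)) =
      \<xi> \<bullet> (\<Gamma> *\<^sub>v \<xi>) + 2 * ((G *\<^sub>v \<xi>) \<bullet> (\<Xi> *\<^sub>v \<zeta>)) + \<zeta> \<bullet> (\<Xi> *\<^sub>v \<zeta>)"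
    using \<Phi> \<Gamma> \<Xi> \<xi> \<zeta> cross cross'
    by (subst four_block_mat_mult_vec[of _ m m _ l _ l])
      (auto simp: scalar_prod_append[of _ m _ l] scalar_prod_add_distrib[of _ m]
        scalar_prod_add_distrib[of _ l] mult_mat_vec_carrier[of _ m m] mult_mat_vec_carrier[of _ m l]
        mult_mat_vec_carrier[of _ l l] mult_mat_vec_carrier[of _ l m])
  moreover have "\<xi> \<bullet> (\<Gamma> *\<^sub>v \<xi>) = \<sigma>\<^sup>2 * (x \<bullet> (Pp *\<^sub>v x)) + \<gamma>\<^sup>2 * (w \<bullet> w)
      + e \<bullet> ((N + transpose_mat N + Z) *\<^sub>v e)"
  proof -
    have "(N + transpose_mat N + Z) *\<^sub>v e \<in> carrier_vec ny"
      by (rule mult_mat_vec_carrier[of _ ny ny]) (use c in auto)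
    then show ?thesis
      unfolding \<Gamma>\<xi> unfolding \<xi>_def using c
      by (simp add: scalar_prod_append[of _ nx _ "nw + ny"] scalar_prod_append[of _ nw _ ny]
          del: assoc_add_mat)
  qed
  moreover have "(G *\<^sub>v \<xi>) \<bullet> (\<Xi> *\<^sub>v \<zeta>) =
      (A *\<^sub>v x + B *\<^sub>v (K *\<^sub>v (?y + e))) \<bullet> (Pq *\<^sub>v a) + (F *\<^sub>v x) \<bullet> b
      + ((\<Delta> \<cdot>\<^sub>v (\<Lambda> *\<^sub>v ?y)) @\<^sub>v e) \<bullet> (?R *\<^sub>v (f @\<^sub>v g))"
    unfolding G\<xi> \<Xi>\<zeta> using c Rfg
    by (simp add: scalar_prod_append[of _ nx _ "nz + (ny + ny)"] scalar_prod_append[of _ nz _ "ny + ny"])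
  moreover have "\<zeta> \<bullet> (\<Xi> *\<^sub>v \<zeta>) = a \<bullet> (Pq *\<^sub>v a) + b \<bullet> b + (f @\<^sub>v g) \<bullet> (?R *\<^sub>v (f @\<^sub>v g))"
    unfolding \<Xi>\<zeta> unfolding \<zeta>_def using c Rfg
    by (simp add: scalar_prod_append[of _ nx _ "nz + (ny + ny)"] scalar_prod_append[of _ nz _ "ny + ny"])
  ultimately show ?thesis unfolding LMI \<xi>_def[symmetric] \<zeta>_def[symmetric]
    by (simp only: add.assoc)
qed

lemma finite_J_set: "finite (J_set n)"
proof (rule finite_subset)
  show "J_set n \<subseteq> vec n ` ({..<n} \<rightarrow>\<^sub>E {1, - 1})"
  proof
    fix j assume "j \<in> J_set n"
    then have "j = vec n (\<lambda>i\<in>{..<n}. j $ i)" "(\<lambda>i\<in>{..<n}. j $ i) \<in> {..<n} \<rightarrow>\<^sub>E {1, - 1}"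
      by (auto simp: J_set_def intro!: eq_vecI)
    then show "j \<in> vec n ` ({..<n} \<rightarrow>\<^sub>E {1, - 1})" by (rule image_eqI)
  qed
qed (simp add: finite_PiE)

text \<open>The minimum of finitely many margins is again a margin, because v . v is nonnegative. It
  is applied to all triples (p, q, j) at once.\<close>

lemma pd_mat_coercive_uniform:
  assumes "finite S" "\<And>s. s \<in> S \<Longrightarrow> pd_mat n (M s)"
  shows "\<exists>\<epsilon>>0. \<forall>s\<in>S. \<forall>v\<in>carrier_vec n. \<epsilon> * (v \<bullet> v) \<le> v \<bullet> (M s *\<^sub>v v)"
  using assms
proof (induction S)
  case empty
  then show ?case by (auto intro: exI[of _ 1])
next
  case (insert s S)
  then obtain \<epsilon>1 where 1: "\<epsilon>1 > 0" "\<forall>s\<in>S. \<forall>v\<in>carrier_vec n. \<epsilon>1 * (v \<bullet> v) \<le> v \<bullet> (M s *\<^sub>v v)" by auto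
  obtain \<epsilon>2 where 2: "\<epsilon>2 > 0" "\<forall>v\<in>carrier_vec n. \<epsilon>2 * (v \<bullet> v) \<le> v \<bullet> (M s *\<^sub>v v)"
    using pd_mat_coercive insert.prems by blast
  have "min \<epsilon>1 \<epsilon>2 * (v \<bullet> v) \<le> v \<bullet> (M r *\<^sub>v v)" if "r \<in> insert s S" "v \<in> carrier_vec n" for r v
  proof -
    have "min \<epsilon>1 \<epsilon>2 * (v \<bullet> v) \<le> \<epsilon>1 * (v \<bullet> v)" "min \<epsilon>1 \<epsilon>2 * (v \<bullet> v) \<le> \<epsilon>2 * (v \<bullet> v)"
      by (intro mult_right_mono scalar_prod_nonneg_real; simp)+
    then show ?thesis using 1(2) 2(2) that by fastforce
  qed
  then show ?case using 1(1) 2(1) by (intro exI[of _ "min \<epsilon>1 \<epsilon>2"]) auto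
qed

lemma pd_mat_nonneg:
  assumes "pd_mat n M" "v \<in> carrier_vec n"
  shows "v \<bullet> (M *\<^sub>v v) \<ge> 0"
  using assms by (cases "v = 0\<^sub>v n") (auto simp: pd_mat_def less_imp_le)

lemma smult_append_vec: "k \<cdot>\<^sub>v (u @\<^sub>v v) = (k \<cdot>\<^sub>v u) @\<^sub>v (k \<cdot>\<^sub>v v)"
  by (intro eq_vecI) auto

lemma sym_four_block_mat_diag:
  assumes "L \<in> carrier_mat n n" "M \<in> carrier_mat n n" "N \<in> carrier_mat n n"
    and "sym_mat (2 * n) (four_block_mat L N (transpose_mat N) M)"
  shows "transpose_mat L = L" "transpose_mat M = M"
proof -
  let ?Q = "four_block_mat L N (transpose_mat N) M"
  have "?Q $$ (i, k) = ?Q $$ (k, i)" if "i < 2 * n" "k < 2 * n" for i k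
    using assms(4) that unfolding sym_mat_def by (metis carrier_matD index_transpose_mat(1))
  note Q = this
  show "transpose_mat L = L"
  proof (rule eq_matI)
    show "transpose_mat L $$ (i, k) = L $$ (i, k)" if "i < dim_row L" "k < dim_col L" for i k
      using Q[of i k] assms that by auto
  qed (use assms in auto)
  show "transpose_mat M = M"
  proof (rule eq_matI)
    show "transpose_mat M $$ (i, k) = M $$ (i, k)" if "i < dim_row M" "k < dim_col M" for i k
      using Q[of "n + i" "n + k"] assms that by auto
  qed (use assms in auto)
qed

lemma nonneg_four_block_mat:
  assumes "L \<in> carrier_mat n n" "M \<in> carrier_mat n n" "N \<in> carrier_mat n n"
    and "nonneg_entries (four_block_mat L N (transpose_mat N) M)" and "i < n" "k < n"
  shows "L $$ (i, k) \<ge> 0" "M $$ (i, k) \<ge> 0" "N $$ (i, k) \<ge> 0"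
proof -
  let ?Q = "four_block_mat L N (transpose_mat N) M"
  have Q: "?Q $$ (r, s) \<ge> 0" if "r < n + n" "s < n + n" for r s
    using assms that by (simp add: nonneg_entries_def)
  show "L $$ (i, k) \<ge> 0" using Q[of i k] assms by simp
  show "M $$ (i, k) \<ge> 0" using Q[of "n + i" "n + k"] assms by simp
  show "N $$ (i, k) \<ge> 0" using Q[of i "n + k"] assms by simp
qed

text \<open>The bound |e_i| <= f_i says precisely that f + e and f - e lie in the nonnegative
  orthant, where entrywise nonnegative matrices give nonnegative bilinear forms. This is an
  S-procedure with copositive instead of semidefinite multipliers.\<close>

lemma sector_block_le:
  fixes L M N Z :: "real mat"
  assumes "L \<in> carrier_mat n n" "M \<in> carrier_mat n n" "N \<in> carrier_mat n n" "Z \<in> carrier_mat n n"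
    and "sym_mat (2 * n) (four_block_mat L N (transpose_mat N) M)"
    and "nonneg_entries (four_block_mat L N (transpose_mat N) M)"
    and fe: "f \<in> carrier_vec n" "e \<in> carrier_vec n" "\<And>i. i < n \<Longrightarrow> \<bar>e $ i\<bar> \<le> f $ i"
  shows "e \<bullet> ((N + transpose_mat N + Z) *\<^sub>v e) \<le> (f @\<^sub>v e) \<bullet> (R_mat L M N Z *\<^sub>v (f @\<^sub>v e))"
proof -
  note Q = nonneg_four_block_mat[OF assms(1-3,6)]
  have c: "f + e \<in> carrier_vec n" "f - e \<in> carrier_vec n" using fe by auto
  have pos: "(f + e) $ i \<ge> 0" "(f - e) $ i \<ge> 0" if "i < n" for i
    using fe(3)[OF that] fe(1,2) that by auto
  have "(f + e) \<bullet> (L *\<^sub>v (f + e)) \<ge> 0" "(f - e) \<bullet> (M *\<^sub>v (f - e)) \<ge> 0"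
    "(f + e) \<bullet> (N *\<^sub>v (f - e)) \<ge> 0"
    by (rule quad_form_nonneg[OF assms(1) c(1,1)] quad_form_nonneg[OF assms(2) c(2,2)]
        quad_form_nonneg[OF assms(3) c]; use Q pos in blast)+
  then show ?thesis
    using sector_block_identity[OF assms(1-4) sym_four_block_mat_diag[OF assms(1-3,5)] fe(1,2)]
    by linarith
qed

section \<open>Dissipation inequality\<close>

text \<open>The data common to the three claims. The thresholds \<open>del\<close> stay outside
  because decay rate and gain concern zero thresholds, practical stability given ones.\<close>

locale etod_lmi =
  fixes nx nu ny nw nz :: nat
    and A B C D F K1 K2 :: "real mat"
    and Dmin Dmax \<sigma> \<gamma> :: real
    and lam :: "nat \<Rightarrow> real"
    and P :: "nat \<Rightarrow> real mat"
    and L M N Z :: "nat \<Rightarrow> real vec \<Rightarrow> real mat"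
  assumes dims: "A \<in> carrier_mat nx nx" "B \<in> carrier_mat nx nu" "C \<in> carrier_mat ny nx"
      "D \<in> carrier_mat ny nw" "F \<in> carrier_mat nz nx"
      "K1 \<in> carrier_mat nu ny" "K2 \<in> carrier_mat nu ny"
    and Delta: "0 \<le> Dmin" "Dmin < Dmax"
    and lam_pos: "\<And>i. i < ny \<Longrightarrow> 0 < lam i"
    and sigma: "0 < \<sigma>" "\<sigma> \<le> 1"
    and P_pd: "\<And>p. p \<in> {1, 2} \<Longrightarrow> pd_mat nx (P p)"
    and LMN: "\<And>p j. p \<in> {1, 2} \<Longrightarrow> j \<in> J_set ny \<Longrightarrow>
        L p j \<in> carrier_mat ny ny \<and> M p j \<in> carrier_mat ny ny \<and> N p j \<in> carrier_mat ny ny \<and>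
        sym_mat (2 * ny) (four_block_mat (L p j) (N p j) (transpose_mat (N p j)) (M p j)) \<and>
        nonneg_entries (four_block_mat (L p j) (N p j) (transpose_mat (N p j)) (M p j))"
    and Z_sym: "\<And>p j. p \<in> {1, 2} \<Longrightarrow> j \<in> J_set ny \<Longrightarrow> sym_mat ny (Z p j)"
    and LMI: "\<And>p q j. p \<in> {1, 2} \<Longrightarrow> q \<in> {1, 2} \<Longrightarrow> j \<in> J_set ny \<Longrightarrow>
        pd_mat ((nx + nw + ny) + (nx + nz + 2 * ny))
          (LMI_mat nx nu ny nw nz A B C D F \<sigma> \<gamma> (P p) (P q)
             (if p = 1 then K1 else K2) (if p = 1 then Dmin else Dmax) (Lam_mat ny lam j)
             (L q j) (M q j) (N q j) (Z q j))"
begin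

text \<open>The parameter a stands for the weight alpha_2, and 1 - a for alpha_1. Threshold, gain
  and storage function are all affine in a, which is what the convexity argument uses.\<close>

definition Del :: "real \<Rightarrow> real" where
  "Del a = (1 - a) * Dmin + a * Dmax"

definition Kint :: "real \<Rightarrow> real mat" where
  "Kint a = (1 - a) \<cdot>\<^sub>m K1 + a \<cdot>\<^sub>m K2"

definition V :: "real \<Rightarrow> real vec \<Rightarrow> real" where
  "V a x = (1 - a) * (x \<bullet> (P 1 *\<^sub>v x)) + a * (x \<bullet> (P 2 *\<^sub>v x))"

lemma P_carrier [simp]: "p \<in> {1, 2} \<Longrightarrow> P p \<in> carrier_mat nx nx"
  using P_pd by (simp add: pd_mat_def)

lemma Kint_carrier: "Kint a \<in> carrier_mat nu ny"
  using dims by (simp add: Kint_def)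

lemma Kint_mult_vec:
  assumes "v \<in> carrier_vec ny"
  shows "Kint a *\<^sub>v v = (1 - a) \<cdot>\<^sub>v (K1 *\<^sub>v v) + a \<cdot>\<^sub>v (K2 *\<^sub>v v)"
  unfolding Kint_def using dims assms
  by (simp add: add_mult_distrib_mat_vec[of _ nu ny] smult_mat_mult_vec[of _ nu ny])

text \<open>The vectors xp and f remain arbitrary here; they will be the interpolated successor and
  the interpolated error bound, which belong to neither p = 1 nor p = 2 alone.\<close>

lemma LMI_test:
  assumes x: "x \<in> carrier_vec nx" and w: "w \<in> carrier_vec nw" and e: "e \<in> carrier_vec ny"
    and xp: "xp \<in> carrier_vec nx" and f: "f \<in> carrier_vec ny"
    and p: "p \<in> {1, 2}" and q: "q \<in> {1, 2}" and j: "j \<in> J_set ny"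
    and \<epsilon>: "\<epsilon> > 0" "\<forall>v\<in>carrier_vec ((nx + nw + ny) + (nx + nz + 2 * ny)). \<epsilon> * (v \<bullet> v) \<le>
      v \<bullet> (LMI_mat nx nu ny nw nz A B C D F \<sigma> \<gamma> (P p) (P q)
             (if p = 1 then K1 else K2) (if p = 1 then Dmin else Dmax) (Lam_mat ny lam j)
             (L q j) (M q j) (N q j) (Z q j) *\<^sub>v v)"
  defines "Kp \<equiv> if p = 1 then K1 else K2" and "\<Delta> \<equiv> if p = 1 then Dmin else Dmax"
    and "R \<equiv> R_mat (L q j) (M q j) (N q j) (Z q j)" and "y \<equiv> C *\<^sub>v x + D *\<^sub>v w"
  shows "\<epsilon> * (x \<bullet> x) \<le> \<sigma>\<^sup>2 * (x \<bullet> (P p *\<^sub>v x)) + \<gamma>\<^sup>2 * (w \<bullet> w)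
      + e \<bullet> ((N q j + transpose_mat (N q j) + Z q j) *\<^sub>v e)
      - 2 * ((A *\<^sub>v x + B *\<^sub>v (Kp *\<^sub>v (y + e))) \<bullet> (P q *\<^sub>v xp))
      - 2 * (((\<Delta> \<cdot>\<^sub>v (Lam_mat ny lam j *\<^sub>v y)) @\<^sub>v e) \<bullet> (R *\<^sub>v (f @\<^sub>v e)))
      + xp \<bullet> (P q *\<^sub>v xp) - (F *\<^sub>v x) \<bullet> (F *\<^sub>v x) + (f @\<^sub>v e) \<bullet> (R *\<^sub>v (f @\<^sub>v e))"
proof -
  \<comment> \<open>Negation is kept as an opaque function so that signs move through products and
    appended blocks only by the rules stated next.\<close>
  define m where "m v = (-1 :: real) \<cdot>\<^sub>v v" for v
  have mc: "m v \<in> carrier_vec n \<longleftrightarrow> v \<in> carrier_vec n" for v n by (simp add: m_def)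
  have mm: "m u \<bullet> v = - (u \<bullet> v)" if "dim_vec u = dim_vec v" for u v
    using that by (simp add: m_def)
  have mm': "u \<bullet> m v = - (u \<bullet> v)" if "dim_vec u = dim_vec v" for u v
    using that by (simp add: m_def)
  have mmm: "m u \<bullet> m v = u \<bullet> v" if "dim_vec u = dim_vec v" for u v
    using that by (simp add: m_def)
  have mM: "T *\<^sub>v m v = m (T *\<^sub>v v)" if "T \<in> carrier_mat n k" "v \<in> carrier_vec k" for T n k v
    using that by (simp add: m_def mult_mat_vec[of _ n k])
  have ma: "m u @\<^sub>v m v = m (u @\<^sub>v v)" for u v by (simp add: m_def smult_append_vec)
  have K: "Kp \<in> carrier_mat nu ny" using dims by (simp add: Kp_def)
  have \<Lambda>: "Lam_mat ny lam j \<in> carrier_mat ny ny" by (simp add: Lam_mat_def)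
  have LMNZ: "L q j \<in> carrier_mat ny ny" "M q j \<in> carrier_mat ny ny" "N q j \<in> carrier_mat ny ny"
    "Z q j \<in> carrier_mat ny ny" using LMN[OF q j] Z_sym[OF q j] by (auto simp: sym_mat_def)
  have R: "R \<in> carrier_mat (ny + ny) (ny + ny)" unfolding R_def using LMNZ by blast
  have Fx: "F *\<^sub>v x \<in> carrier_vec nz" using dims x by simp
  have Pxp: "P q *\<^sub>v xp \<in> carrier_vec nx" by (rule mult_mat_vec_carrier[OF P_carrier[OF q] xp])
  have Rfe: "R *\<^sub>v (f @\<^sub>v e) \<in> carrier_vec (ny + ny)"
    by (rule mult_mat_vec_carrier[OF R]) (use e f in auto)
  let ?v = "(x @\<^sub>v (w @\<^sub>v e)) @\<^sub>v (m xp @\<^sub>v (m (F *\<^sub>v x) @\<^sub>v (m f @\<^sub>v m e)))"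
  have v: "?v \<in> carrier_vec ((nx + (nw + ny)) + (nx + (nz + (ny + ny))))"
    by (intro append_carrier_vec) (use x w e xp f Fx in \<open>auto simp: mc\<close>)
  then have v': "?v \<in> carrier_vec ((nx + nw + ny) + (nx + nz + 2 * ny))"
    by (simp add: add.assoc mult_2)
  \<comment> \<open>Only the share of the margin belonging to the state block is retained; the
    remaining blocks contribute squares and are dropped.\<close>
  have "x \<bullet> x \<le> ?v \<bullet> ?v"
  proof -
    let ?t = "m xp @\<^sub>v (m (F *\<^sub>v x) @\<^sub>v (m f @\<^sub>v m e))"
    have t: "?t \<in> carrier_vec (nx + (nz + (ny + ny)))"
      by (intro append_carrier_vec) (use e xp f Fx in \<open>auto simp: mc\<close>)
    have "?v \<bullet> ?v = x \<bullet> x + (w @\<^sub>v e) \<bullet> (w @\<^sub>v e) + ?t \<bullet> ?t"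
      using x w e by (subst scalar_prod_append[OF _ t _ t]; (subst scalar_prod_append)?; auto)
    then show ?thesis using scalar_prod_nonneg_real[of "w @\<^sub>v e"] scalar_prod_nonneg_real[of ?t] by linarith
  qed
  then have "\<epsilon> * (x \<bullet> x) \<le> \<epsilon> * (?v \<bullet> ?v)" using \<epsilon>(1) by simp
  also have "\<dots> \<le> ?v \<bullet> (LMI_mat nx nu ny nw nz A B C D F \<sigma> \<gamma> (P p) (P q) Kp \<Delta> (Lam_mat ny lam j)
      (L q j) (M q j) (N q j) (Z q j) *\<^sub>v ?v)"
    unfolding Kp_def \<Delta>_def using \<epsilon>(2) v' by blast
  also have "\<dots> = \<sigma>\<^sup>2 * (x \<bullet> (P p *\<^sub>v x)) + \<gamma>\<^sup>2 * (w \<bullet> w)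
    + e \<bullet> ((N q j + transpose_mat (N q j) + Z q j) *\<^sub>v e)
    + 2 * ((A *\<^sub>v x + B *\<^sub>v (Kp *\<^sub>v (y + e))) \<bullet> (P q *\<^sub>v m xp) + (F *\<^sub>v x) \<bullet> m (F *\<^sub>v x)
      + ((\<Delta> \<cdot>\<^sub>v (Lam_mat ny lam j *\<^sub>v y)) @\<^sub>v e) \<bullet> (R *\<^sub>v (m f @\<^sub>v m e)))
    + m xp \<bullet> (P q *\<^sub>v m xp) + m (F *\<^sub>v x) \<bullet> m (F *\<^sub>v x) + (m f @\<^sub>v m e) \<bullet> (R *\<^sub>v (m f @\<^sub>v m e))"
    unfolding R_def y_def
    by (rule LMI_mat_quad_form) (use dims K \<Lambda> LMNZ x w e xp f Fx p q in \<open>auto simp: mc\<close>)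
  also have "P q *\<^sub>v m xp = m (P q *\<^sub>v xp)" by (rule mM[OF P_carrier[OF q] xp])
  also have "R *\<^sub>v (m f @\<^sub>v m e) = m (R *\<^sub>v (f @\<^sub>v e))"
    unfolding ma by (rule mM[OF R]) (use e f in auto)
  also have "(A *\<^sub>v x + B *\<^sub>v (Kp *\<^sub>v (y + e))) \<bullet> m (P q *\<^sub>v xp) =
      - ((A *\<^sub>v x + B *\<^sub>v (Kp *\<^sub>v (y + e))) \<bullet> (P q *\<^sub>v xp))"
    by (rule mm') (use dims P_carrier[OF q] in auto)
  also have "((\<Delta> \<cdot>\<^sub>v (Lam_mat ny lam j *\<^sub>v y)) @\<^sub>v e) \<bullet> m (R *\<^sub>v (f @\<^sub>v e)) =
      - (((\<Delta> \<cdot>\<^sub>v (Lam_mat ny lam j *\<^sub>v y)) @\<^sub>v e) \<bullet> (R *\<^sub>v (f @\<^sub>v e)))"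
    by (rule mm') (use e R \<Lambda> in auto)
  also have "(F *\<^sub>v x) \<bullet> m (F *\<^sub>v x) = - ((F *\<^sub>v x) \<bullet> (F *\<^sub>v x))" by (rule mm') simp
  also have "m (F *\<^sub>v x) \<bullet> m (F *\<^sub>v x) = (F *\<^sub>v x) \<bullet> (F *\<^sub>v x)"
    by (simp add: m_def)
  also have "m xp \<bullet> m (P q *\<^sub>v xp) = xp \<bullet> (P q *\<^sub>v xp)"
    using xp Pxp by (simp add: m_def)
  also have "(m f @\<^sub>v m e) \<bullet> m (R *\<^sub>v (f @\<^sub>v e)) = (f @\<^sub>v e) \<bullet> (R *\<^sub>v (f @\<^sub>v e))"
    unfolding ma by (rule mmm) (use e f R in auto)
  finally show ?thesis by (simp add: algebra_simps)
qed

text \<open>The weight b of the next storage function is independent of a, since the next level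
  E[k+1] depends on noise that has not yet acted. The number \<epsilon> is fixed before state,
  noise, error and weights.\<close>

lemma dissipation:
  "\<exists>\<epsilon>>0. \<forall>x\<in>carrier_vec nx. \<forall>w\<in>carrier_vec nw. \<forall>e\<in>carrier_vec ny. \<forall>a\<in>{0..1}. \<forall>b\<in>{0..1}.
    (\<forall>i<ny. \<bar>e $ i\<bar> \<le> Del a * lam i * \<bar>(C *\<^sub>v x + D *\<^sub>v w) $ i\<bar>) \<longrightarrow>
    V b (A *\<^sub>v x + B *\<^sub>v (Kint a *\<^sub>v (C *\<^sub>v x + D *\<^sub>v w + e))) + (F *\<^sub>v x) \<bullet> (F *\<^sub>v x) + \<epsilon> * (x \<bullet> x)
      \<le> \<sigma>\<^sup>2 * V a x + \<gamma>\<^sup>2 * (w \<bullet> w)"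
proof -
  define T where "T = (\<lambda>(p, q, j). LMI_mat nx nu ny nw nz A B C D F \<sigma> \<gamma> (P p) (P q)
             (if p = 1 then K1 else K2) (if p = 1 then Dmin else Dmax) (Lam_mat ny lam j)
             (L q j) (M q j) (N q j) (Z q j))"
  let ?S = "{1, 2 :: nat} \<times> {1, 2 :: nat} \<times> J_set ny"
  let ?n = "(nx + nw + ny) + (nx + nz + 2 * ny)"
  have "pd_mat ?n (T s)" if s: "s \<in> ?S" for s
  proof -
    obtain p q j where s_eq: "s = (p, q, j)" and "p \<in> {1, 2}" "q \<in> {1, 2}" "j \<in> J_set ny"
      using s by blast
    then show ?thesis unfolding s_eq T_def prod.case by (intro LMI)
  qed
  moreover have "finite ?S" by (simp add: finite_J_set)
  ultimately obtain \<epsilon> where \<epsilon>: "\<epsilon> > 0"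
    and T\<epsilon>: "\<forall>s\<in>?S. \<forall>v\<in>carrier_vec ?n. \<epsilon> * (v \<bullet> v) \<le> v \<bullet> (T s *\<^sub>v v)"
    using pd_mat_coercive_uniform[of ?S ?n T] by blast
  have LMI\<epsilon>: "\<forall>v\<in>carrier_vec ?n. \<epsilon> * (v \<bullet> v) \<le>
      v \<bullet> (LMI_mat nx nu ny nw nz A B C D F \<sigma> \<gamma> (P p) (P q)
             (if p = 1 then K1 else K2) (if p = 1 then Dmin else Dmax) (Lam_mat ny lam j)
             (L q j) (M q j) (N q j) (Z q j) *\<^sub>v v)"
    if "p \<in> {1, 2}" "q \<in> {1, 2}" "j \<in> J_set ny" for p q j
    using T\<epsilon>[rule_format, of "(p, q, j)"] that unfolding T_def prod.case by blast
  show ?thesis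
  proof (intro exI[of _ \<epsilon>] conjI ballI impI \<epsilon>)
    fix x w e :: "real vec" and a b :: real
    assume x: "x \<in> carrier_vec nx" and w: "w \<in> carrier_vec nw" and e: "e \<in> carrier_vec ny"
      and a: "a \<in> {0..1}" and b: "b \<in> {0..1}"
      and sec: "\<forall>i<ny. \<bar>e $ i\<bar> \<le> Del a * lam i * \<bar>(C *\<^sub>v x + D *\<^sub>v w) $ i\<bar>"
    define y where "y = C *\<^sub>v x + D *\<^sub>v w"
    have y: "y \<in> carrier_vec ny" using dims x w by (simp add: y_def)
    \<comment> \<open>The sign pattern of y, with 1 as default for a zero entry, where the choice
      has no effect on \<open>Lam_mat ny lam j *\<^sub>v y\<close>.\<close>
    define j where "j = vec ny (\<lambda>i. if y $ i \<ge> 0 then 1 else - 1 :: real)"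
    have j: "j \<in> J_set ny" by (auto simp: j_def J_set_def)
    define g where "g = Lam_mat ny lam j *\<^sub>v y"
    have g: "g \<in> carrier_vec ny" unfolding g_def
      by (rule mult_mat_vec_carrier[OF _ y]) (simp add: Lam_mat_def)
    have gi: "g $ i = lam i * \<bar>y $ i\<bar>" if "i < ny" for i
    proof -
      have "g $ i = (\<Sum>k\<in>{0..<ny}. (if i = k then lam i * j $ i else 0) * y $ k)"
        using that y unfolding g_def Lam_mat_def by (simp add: scalar_prod_def)
      also have "\<dots> = (\<Sum>k\<in>{0..<ny}. if k = i then lam i * j $ i * y $ k else 0)"
        by (intro sum.cong) auto
      also have "\<dots> = lam i * j $ i * y $ i" using that by (simp add: sum.delta)
      finally show ?thesis using that by (simp add: j_def)
    qed
    define f where "f = Del a \<cdot>\<^sub>v g"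
    have f: "f \<in> carrier_vec ny" using g by (simp add: f_def)
    have fe: "\<bar>e $ i\<bar> \<le> f $ i" if "i < ny" for i
      using sec that g gi[OF that] by (simp add: f_def y_def[symmetric] mult.assoc)
    define h where "h K = A *\<^sub>v x + B *\<^sub>v (K *\<^sub>v (y + e))" for K
    have h: "h K \<in> carrier_vec nx" for K
      unfolding h_def using dims by (intro carrier_vecI) auto
    define xp where "xp = h (Kint a)"
    have xp: "xp \<in> carrier_vec nx" using h by (simp add: xp_def)
    have xp_eq: "xp = (1 - a) \<cdot>\<^sub>v h K1 + a \<cdot>\<^sub>v h K2"
    proof -
      have "B *\<^sub>v (Kint a *\<^sub>v (y + e)) =
          (1 - a) \<cdot>\<^sub>v (B *\<^sub>v (K1 *\<^sub>v (y + e))) + a \<cdot>\<^sub>v (B *\<^sub>v (K2 *\<^sub>v (y + e)))"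
        using dims y e
        by (simp add: Kint_mult_vec mult_add_distrib_mat_vec[of _ nx nu] mult_mat_vec[of _ nx nu])
      moreover have "A *\<^sub>v x = (1 - a) \<cdot>\<^sub>v (A *\<^sub>v x) + a \<cdot>\<^sub>v (A *\<^sub>v x)"
        using dims x by (intro eq_vecI) (auto simp: algebra_simps)
      ultimately show ?thesis
        unfolding xp_def h_def using dims by (intro eq_vecI) (auto simp: algebra_simps)
    qed
    \<comment> \<open>With q fixed, j depends on y alone, so both values of p meet the same
      \<open>P q\<close> and the same R-block, and averaging over p is legitimate.\<close>
    have q_ineq: "xp \<bullet> (P q *\<^sub>v xp) + (F *\<^sub>v x) \<bullet> (F *\<^sub>v x) + \<epsilon> * (x \<bullet> x) \<le> \<sigma>\<^sup>2 * V a x + \<gamma>\<^sup>2 * (w \<bullet> w)"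
      if q: "q \<in> {1, 2}" for q
    proof -
      let ?R = "R_mat (L q j) (M q j) (N q j) (Z q j)"
      note LMNq = LMN[OF q j]
      have Z: "Z q j \<in> carrier_mat ny ny" using Z_sym[OF q j] by (simp add: sym_mat_def)
      let ?Ne = "e \<bullet> ((N q j + transpose_mat (N q j) + Z q j) *\<^sub>v e)"
      have sector: "?Ne \<le> (f @\<^sub>v e) \<bullet> (?R *\<^sub>v (f @\<^sub>v e))"
        by (rule sector_block_le[OF _ _ _ Z _ _ f e fe]) (use LMNq in auto)
      note t1 = LMI_test[OF x w e xp f _ q j \<epsilon> LMI\<epsilon>[OF _ q j], of 1, simplified,
          folded y_def, folded g_def h_def]
      note t2 = LMI_test[OF x w e xp f _ q j \<epsilon> LMI\<epsilon>[OF _ q j], of 2, simplified,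
          folded y_def, folded g_def h_def]
      have Pxp: "P q *\<^sub>v xp \<in> carrier_vec nx" by (rule mult_mat_vec_carrier[OF P_carrier[OF q] xp])
      have Rfe: "?R *\<^sub>v (f @\<^sub>v e) \<in> carrier_vec (ny + ny)"
        by (rule mult_mat_vec_carrier[OF R_mat_carrier]) (use e f LMNq Z in auto)
      have h_sum: "(1 - a) * (h K1 \<bullet> (P q *\<^sub>v xp)) + a * (h K2 \<bullet> (P q *\<^sub>v xp)) = xp \<bullet> (P q *\<^sub>v xp)"
      proof -
        have "xp \<bullet> z = (1 - a) * (h K1 \<bullet> z) + a * (h K2 \<bullet> z)" if "z \<in> carrier_vec nx" for z
          unfolding xp_eq using h[of K1] h[of K2] that
          by (simp add: add_scalar_prod_distrib[of _ nx] smult_scalar_prod_distrib[of _ nx])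
        then show ?thesis using Pxp by simp
      qed
      \<comment> \<open>The block e does not depend on p; it survives the average because the
        weights add up to 1.\<close>
      have fe_eq: "f @\<^sub>v e = (1 - a) \<cdot>\<^sub>v ((Dmin \<cdot>\<^sub>v g) @\<^sub>v e) + a \<cdot>\<^sub>v ((Dmax \<cdot>\<^sub>v g) @\<^sub>v e)"
        using g e unfolding f_def Del_def by (intro eq_vecI) (auto simp: algebra_simps)
      have "((1 - a) \<cdot>\<^sub>v ((Dmin \<cdot>\<^sub>v g) @\<^sub>v e) + a \<cdot>\<^sub>v ((Dmax \<cdot>\<^sub>v g) @\<^sub>v e)) \<bullet> (?R *\<^sub>v (f @\<^sub>v e)) =
          (1 - a) * (((Dmin \<cdot>\<^sub>v g) @\<^sub>v e) \<bullet> (?R *\<^sub>v (f @\<^sub>v e))) + a * (((Dmax \<cdot>\<^sub>v g) @\<^sub>v e) \<bullet> (?R *\<^sub>v (f @\<^sub>v e)))"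
      proof -
        have "(t \<cdot>\<^sub>v g) @\<^sub>v e \<in> carrier_vec (ny + ny)" for t using g e by simp
        then show ?thesis using Rfe
          by (simp add: add_scalar_prod_distrib[of _ "ny + ny"] smult_scalar_prod_distrib[of _ "ny + ny"])
      qed
      then have f_sum: "(1 - a) * (((Dmin \<cdot>\<^sub>v g) @\<^sub>v e) \<bullet> (?R *\<^sub>v (f @\<^sub>v e)))
          + a * (((Dmax \<cdot>\<^sub>v g) @\<^sub>v e) \<bullet> (?R *\<^sub>v (f @\<^sub>v e))) = (f @\<^sub>v e) \<bullet> (?R *\<^sub>v (f @\<^sub>v e))"
        unfolding fe_eq[symmetric] by simp
      have conv: "s \<le> (1 - a) * u1 + a * u2" if "s \<le> u1" "s \<le> u2" for s u1 u2 :: real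
      proof -
        have "(1 - a) * s + a * s \<le> (1 - a) * u1 + a * u2"
          using a that by (intro add_mono mult_left_mono) auto
        then show ?thesis by (simp add: algebra_simps)
      qed
      \<comment> \<open>Once \<open>h_sum\<close> and \<open>f_sum\<close> collapse the averages,
        each form appears with -2 + 1 = -1. The remaining difference between the e-term and the
        R-form is removed by \<open>sector\<close>.\<close>
      have "\<epsilon> * (x \<bullet> x) \<le> \<sigma>\<^sup>2 * V a x + \<gamma>\<^sup>2 * (w \<bullet> w) + ?Ne
          - 2 * ((1 - a) * (h K1 \<bullet> (P q *\<^sub>v xp)) + a * (h K2 \<bullet> (P q *\<^sub>v xp)))
          - 2 * ((1 - a) * (((Dmin \<cdot>\<^sub>v g) @\<^sub>v e) \<bullet> (?R *\<^sub>v (f @\<^sub>v e)))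
            + a * (((Dmax \<cdot>\<^sub>v g) @\<^sub>v e) \<bullet> (?R *\<^sub>v (f @\<^sub>v e))))
          + xp \<bullet> (P q *\<^sub>v xp) - (F *\<^sub>v x) \<bullet> (F *\<^sub>v x) + (f @\<^sub>v e) \<bullet> (?R *\<^sub>v (f @\<^sub>v e))"
        by (rule order_trans[OF conv[OF t1 t2]]) (simp add: V_def algebra_simps)
      then show ?thesis unfolding h_sum f_sum using sector by linarith
    qed
    \<comment> \<open>The right-hand side does not involve q, so the average with weights 1 - b and
      b only changes the storage function on the left.\<close>
    have "(1 - b) * (xp \<bullet> (P 1 *\<^sub>v xp) + (F *\<^sub>v x) \<bullet> (F *\<^sub>v x) + \<epsilon> * (x \<bullet> x))
        + b * (xp \<bullet> (P 2 *\<^sub>v xp) + (F *\<^sub>v x) \<bullet> (F *\<^sub>v x) + \<epsilon> * (x \<bullet> x))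
        \<le> (1 - b) * (\<sigma>\<^sup>2 * V a x + \<gamma>\<^sup>2 * (w \<bullet> w)) + b * (\<sigma>\<^sup>2 * V a x + \<gamma>\<^sup>2 * (w \<bullet> w))"
      using b by (intro add_mono mult_left_mono q_ineq) auto
    then have "V b xp + (F *\<^sub>v x) \<bullet> (F *\<^sub>v x) + \<epsilon> * (x \<bullet> x) \<le> \<sigma>\<^sup>2 * V a x + \<gamma>\<^sup>2 * (w \<bullet> w)"
      unfolding V_def[of b] by (simp add: algebra_simps)
    then show "V b (A *\<^sub>v x + B *\<^sub>v (Kint a *\<^sub>v (C *\<^sub>v x + D *\<^sub>v w + e))) + (F *\<^sub>v x) \<bullet> (F *\<^sub>v x) + \<epsilon> * (x \<bullet> x)
      \<le> \<sigma>\<^sup>2 * V a x + \<gamma>\<^sup>2 * (w \<bullet> w)"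
      unfolding xp_def h_def y_def .
  qed
qed

end

section \<open>Maximum norms\<close>

lemma inorm_finite: "finite (insert 0 {\<bar>v $ i\<bar> | i. i < dim_vec v})"
proof -
  have "{\<bar>v $ i\<bar> | i. i < dim_vec v} = (\<lambda>i. \<bar>v $ i\<bar>) ` {..<dim_vec v}" by auto
  then show ?thesis by simp
qed

lemma abs_index_le_inorm: "i < dim_vec v \<Longrightarrow> \<bar>v $ i\<bar> \<le> inorm v"
  unfolding inorm_def by (intro Max_ge inorm_finite) auto

lemma inorm_nonneg: "0 \<le> inorm v"
  unfolding inorm_def by (intro Max_ge inorm_finite) auto

lemma inorm_le: "0 \<le> c \<Longrightarrow> (\<And>i. i < dim_vec v \<Longrightarrow> \<bar>v $ i\<bar> \<le> c) \<Longrightarrow> inorm v \<le> c"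
  unfolding inorm_def by (subst Max_le_iff[OF inorm_finite]) auto

text \<open>The supremum in \<open>inorm_mat\<close> is meaningful only for a set bounded above; the
  sum of all absolute entries serves as such a bound.\<close>

lemma inorm_mat_upper:
  assumes M: "M \<in> carrier_mat n m" and v: "v \<in> carrier_vec m" "inorm v \<le> 1"
  shows "inorm (M *\<^sub>v v) \<le> inorm_mat M"
  unfolding inorm_mat_def
proof (rule cSup_upper)
  define c where "c = (\<Sum>i<n. \<Sum>k<m. \<bar>M $$ (i, k)\<bar>)"
  show "bdd_above {inorm (M *\<^sub>v v) |v. v \<in> carrier_vec (dim_col M) \<and> inorm v \<le> 1}"
  proof (rule bdd_aboveI[of _ c], clarify)
    fix u :: "real vec" assume u: "u \<in> carrier_vec (dim_col M)" "inorm u \<le> 1"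
    show "inorm (M *\<^sub>v u) \<le> c"
    proof (rule inorm_le)
      show "0 \<le> c" unfolding c_def by (intro sum_nonneg) auto
      fix i assume "i < dim_vec (M *\<^sub>v u)"
      then have i: "i < n" using M by simp
      have "\<bar>(M *\<^sub>v u) $ i\<bar> = \<bar>\<Sum>k<m. M $$ (i, k) * u $ k\<bar>"
        using M u i by (simp add: scalar_prod_def atLeast0LessThan)
      also have "\<dots> \<le> (\<Sum>k<m. \<bar>M $$ (i, k) * u $ k\<bar>)" by (rule sum_abs)
      also have "\<dots> \<le> (\<Sum>k<m. \<bar>M $$ (i, k)\<bar>)"
      proof (rule sum_mono)
        fix k assume "k \<in> {..<m}"
        then have "\<bar>u $ k\<bar> \<le> 1" using abs_index_le_inorm[of k u] u M by auto
        then show "\<bar>M $$ (i, k) * u $ k\<bar> \<le> \<bar>M $$ (i, k)\<bar>"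
          by (simp add: abs_mult mult_left_le)
      qed
      also have "\<dots> \<le> c" unfolding c_def
        by (rule member_le_sum[where f = "\<lambda>i. \<Sum>k<m. \<bar>M $$ (i, k)\<bar>"])
          (use i in \<open>auto intro: sum_nonneg\<close>)
      finally show "\<bar>(M *\<^sub>v u) $ i\<bar> \<le> c" .
    qed
  qed
qed (use M v in auto)

lemma inorm_mat_nonneg:
  assumes "M \<in> carrier_mat n m"
  shows "0 \<le> inorm_mat M"
proof -
  have "inorm (0\<^sub>v m) \<le> 1" by (rule inorm_le) auto
  then have "inorm (M *\<^sub>v 0\<^sub>v m) \<le> inorm_mat M" by (intro inorm_mat_upper[OF assms]) auto
  then show ?thesis using inorm_nonneg[of "M *\<^sub>v 0\<^sub>v m"] by linarith
qed

text \<open>Homogeneity reduces the claim to the unit ball by scaling with 1/c. For c = 0, where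
  this is impossible, v itself vanishes.\<close>

lemma mult_mat_vec_index_le_inorm:
  assumes M: "M \<in> carrier_mat n m" and v: "v \<in> carrier_vec m" "inorm v \<le> c" and i: "i < n"
  shows "\<bar>(M *\<^sub>v v) $ i\<bar> \<le> c * inorm_mat M"
proof (cases "c > 0")
  case True
  have "inorm ((1 / c) \<cdot>\<^sub>v v) \<le> 1"
    by (rule inorm_le) (use True order_trans[OF abs_index_le_inorm v(2)] in \<open>auto simp: abs_mult\<close>)
  then have "inorm (M *\<^sub>v ((1 / c) \<cdot>\<^sub>v v)) \<le> inorm_mat M"
    using v by (intro inorm_mat_upper[OF M]) auto
  moreover have "\<bar>(M *\<^sub>v ((1 / c) \<cdot>\<^sub>v v)) $ i\<bar> \<le> inorm (M *\<^sub>v ((1 / c) \<cdot>\<^sub>v v))"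
    by (rule abs_index_le_inorm) (use M i in auto)
  ultimately have "\<bar>1 / c * (M *\<^sub>v v) $ i\<bar> \<le> inorm_mat M"
    using M v i by (simp add: mult_mat_vec[OF M])
  then show ?thesis using True by (simp add: abs_mult field_simps)
next
  case False
  then have c: "c = 0" using v(2) inorm_nonneg[of v] by linarith
  then have "v = 0\<^sub>v m"
    using v order_trans[OF abs_index_le_inorm v(2)] by (intro eq_vecI) auto
  then show ?thesis using M i c by simp
qed

section \<open>Closed-loop trajectories\<close>

text \<open>For y = 0 the conventions do the work: a finite upper bound excludes the value
  \<infinity>, which leaves |e| <= d.\<close>

lemma Eprime_le:
  assumes "Eprime l d e y \<le> ereal E" "l > 0" "0 \<le> E"
  shows "\<bar>e\<bar> \<le> E * l * \<bar>y\<bar> + d"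
proof (cases "y = 0")
  case True
  then show ?thesis using assms by (auto simp: Eprime_def split: if_splits)
next
  case False
  then have "(\<bar>e\<bar> - d) / (l * \<bar>y\<bar>) \<le> E" "l * \<bar>y\<bar> > 0" using assms by (auto simp: Eprime_def)
  then show ?thesis by (simp add: field_simps)
qed

context etod_lmi
begin

lemma Del_nonneg: "a \<in> {0..1} \<Longrightarrow> 0 \<le> Del a"
  using Delta by (auto simp: Del_def)

lemma Del_le: "a \<in> {0..1} \<Longrightarrow> Del a \<le> Dmax"
proof -
  assume a: "a \<in> {0..1}"
  have "Dmax - Del a = (1 - a) * (Dmax - Dmin)" by (simp add: Del_def algebra_simps)
  moreover have "\<dots> \<ge> 0" using a Delta by (intro mult_nonneg_nonneg) auto
  ultimately show ?thesis by linarith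
qed

lemma Ksched_eq:
  assumes "E \<in> {Dmin..Dmax}"
  shows "\<exists>a\<in>{0..1}. E = Del a \<and> Ksched Dmin Dmax K1 K2 E = Kint a"
proof (intro bexI conjI)
  define a where "a = (E - Dmin) / (Dmax - Dmin)"
  show "a \<in> {0..1}" using assms Delta by (simp add: a_def)
  have "a * (Dmax - Dmin) = E - Dmin" using Delta by (simp add: a_def)
  then show "E = Del a" by (simp add: Del_def algebra_simps)
  have "1 - a = (Dmax - E) / (Dmax - Dmin)" using Delta by (simp add: a_def field_simps)
  then show "Ksched Dmin Dmax K1 K2 E = Kint a" by (simp add: Ksched_def Kint_def a_def)
qed

text \<open>A transmitted component has zero error. An untransmitted one has E'_i at most the level
  E that schedules the gain, so the weight in the controller and the width of the sector are the
  same a.\<close>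

lemma cl_traj_step:
  assumes ny: "0 < ny" and del: "\<And>i. i < ny \<Longrightarrow> 0 \<le> del i"
    and traj: "cl_traj nx nu ny nw nz A B C D K1 K2 Dmin Dmax lam del h0 x w yt"
  shows "\<exists>a\<in>{0..1}. (\<forall>i<ny. \<bar>yt k $ i - (C *\<^sub>v x k + D *\<^sub>v w k) $ i\<bar>
        \<le> Del a * lam i * \<bar>(C *\<^sub>v x k + D *\<^sub>v w k) $ i\<bar> + del i) \<and>
      x (Suc k) = A *\<^sub>v x k + B *\<^sub>v (Kint a *\<^sub>v yt k)"
proof -
  define y where "y = C *\<^sub>v x k + D *\<^sub>v w k"
  define h where "h = (if k = 0 then h0 else yt (k - 1))"
  define Ep where "Ep i = Eprime (lam i) (del i) (h $ i - y $ i) (y $ i)" for i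
  define mx where "mx = Max (Ep ` {..<ny})"
  obtain T E where T: "T \<subseteq> {..<ny}"
    and low: "mx < ereal Dmin \<longrightarrow> T = {} \<and> E = Dmin"
    and high: "mx \<ge> ereal Dmax \<longrightarrow> T = {i \<in> {..<ny}. Ep i \<ge> ereal Dmax} \<and> E = Dmax"
    and mid: "ereal Dmin \<le> mx \<and> mx < ereal Dmax \<longrightarrow>
                 (\<exists>i0 < ny. Ep i0 = mx \<and> T = {i0}) \<and> mx = ereal E"
    and yt: "\<forall>i < ny. yt k $ i = (if i \<in> T then y $ i else h $ i)"
    and x: "x (Suc k) = A *\<^sub>v x k + B *\<^sub>v (Ksched Dmin Dmax K1 K2 E *\<^sub>v yt k)"
    using traj unfolding cl_traj_def Let_def y_def h_def Ep_def mx_def by blast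
  have Ep_le: "Ep i \<le> mx" if "i < ny" for i
    unfolding mx_def using that by (intro Max_ge) auto
  consider "mx < ereal Dmin" | "mx \<ge> ereal Dmax" | "ereal Dmin \<le> mx" "mx < ereal Dmax"
    by fastforce
  \<comment> \<open>Below Dmin every ratio is below E = Dmin; above Dmax the silent components are
    those with ratio below E = Dmax; in between E is the maximal ratio itself.\<close>
  then have E: "E \<in> {Dmin..Dmax} \<and> (\<forall>i<ny. i \<notin> T \<longrightarrow> Ep i \<le> ereal E)"
  proof cases
    case 1
    then show ?thesis using low Ep_le Delta by fastforce
  next
    case 2
    then show ?thesis using high Delta by auto
  next
    case 3
    then have "mx = ereal E" using mid by auto
    then show ?thesis using 3 Ep_le by auto
  qed
  then obtain a where a: "a \<in> {0..1}" "E = Del a" "Ksched Dmin Dmax K1 K2 E = Kint a"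
    using Ksched_eq by blast
  have "\<bar>yt k $ i - y $ i\<bar> \<le> Del a * lam i * \<bar>y $ i\<bar> + del i" if i: "i < ny" for i
  proof (cases "i \<in> T")
    case True
    then show ?thesis using yt i Del_nonneg[OF a(1)] lam_pos[OF i] del[OF i] by simp
  next
    case False
    then show ?thesis
      using E i yt a Del_nonneg[OF a(1)]
      by (auto intro!: Eprime_le lam_pos simp: Ep_def)
  qed
  then show ?thesis using a x unfolding y_def by (intro bexI[of _ a]) auto
qed

section \<open>Comparison of the interpolated storage function with the squared norm\<close>

lemma V_coercive: "\<exists>c>0. \<forall>a\<in>{0..1}. \<forall>x\<in>carrier_vec nx. c * (x \<bullet> x) \<le> V a x"
proof -
  from pd_mat_coercive_uniform[of "{1, 2}" nx P] P_pd obtain c where "c > 0"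
    and c: "\<forall>s\<in>{1, 2}. \<forall>v\<in>carrier_vec nx. c * (v \<bullet> v) \<le> v \<bullet> (P s *\<^sub>v v)" by blast
  have "c * (x \<bullet> x) \<le> V a x" if "a \<in> {0..1}" "x \<in> carrier_vec nx" for a x
  proof -
    have "(1 - a) * (c * (x \<bullet> x)) + a * (c * (x \<bullet> x)) \<le> V a x"
      unfolding V_def using that c by (intro add_mono mult_left_mono) auto
    then show ?thesis by (simp add: algebra_simps)
  qed
  then show ?thesis using \<open>c > 0\<close> by blast
qed

lemma V_upper: "\<exists>c>0. \<forall>a\<in>{0..1}. \<forall>x\<in>carrier_vec nx. V a x \<le> c * (x \<bullet> x)"
proof -
  obtain c1 where c1: "c1 \<ge> 0" "\<forall>v\<in>carrier_vec nx. v \<bullet> (P 1 *\<^sub>v v) \<le> c1 * (v \<bullet> v)"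
    using quad_form_le[OF P_carrier, of 1] by auto
  obtain c2 where c2: "c2 \<ge> 0" "\<forall>v\<in>carrier_vec nx. v \<bullet> (P 2 *\<^sub>v v) \<le> c2 * (v \<bullet> v)"
    using quad_form_le[OF P_carrier, of 2] by auto
  \<comment> \<open>The added 1 makes the constant strictly positive, since later arguments divide
    by it.\<close>
  have "V a x \<le> (c1 + c2 + 1) * (x \<bullet> x)" if "a \<in> {0..1}" "x \<in> carrier_vec nx" for a x
  proof -
    have "V a x \<le> (1 - a) * (c1 * (x \<bullet> x)) + a * (c2 * (x \<bullet> x))"
      unfolding V_def using that c1 c2 by (intro add_mono mult_left_mono) auto
    also have "\<dots> \<le> 1 * (c1 * (x \<bullet> x)) + 1 * (c2 * (x \<bullet> x))"
      using that c1 c2 scalar_prod_nonneg_real[of x] by (intro add_mono mult_right_mono) auto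
    also have "\<dots> \<le> (c1 + c2 + 1) * (x \<bullet> x)"
      using scalar_prod_nonneg_real[of x] by (simp add: algebra_simps)
    finally show ?thesis .
  qed
  then show ?thesis using c1 c2 by (intro exI[of _ "c1 + c2 + 1"]) auto
qed

lemma V_nonneg: "a \<in> {0..1} \<Longrightarrow> x \<in> carrier_vec nx \<Longrightarrow> 0 \<le> V a x"
  unfolding V_def by (intro add_nonneg_nonneg mult_nonneg_nonneg pd_mat_nonneg[OF P_pd]) auto

lemma V_young:
  assumes "a \<in> {0..1}" "u \<in> carrier_vec nx" "v \<in> carrier_vec nx" "t > 0"
  shows "V a (u + v) \<le> (1 + t) * V a u + (1 + 1 / t) * V a v"
proof -
  define s where "s = 1 / t"
  have "V a (u + v) \<le> (1 - a) * ((1 + t) * (u \<bullet> (P 1 *\<^sub>v u)) + (1 + 1 / t) * (v \<bullet> (P 1 *\<^sub>v v)))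
      + a * ((1 + t) * (u \<bullet> (P 2 *\<^sub>v u)) + (1 + 1 / t) * (v \<bullet> (P 2 *\<^sub>v v)))"
    unfolding V_def using assms by (intro add_mono mult_left_mono quad_form_young[OF P_pd]) auto
  also have "\<dots> = (1 + t) * V a u + (1 + 1 / t) * V a v"
    unfolding V_def s_def[symmetric] by (simp add: algebra_simps)
  finally show ?thesis .
qed

section \<open>Trajectories with zero thresholds: decay rate and gain\<close>

lemma cl_traj_carrier:
  assumes "cl_traj nx nu ny nw nz A B C D K1 K2 Dmin Dmax lam del h0 x w yt"
  shows "x k \<in> carrier_vec nx" "w k \<in> carrier_vec nw" "yt k \<in> carrier_vec ny"
  using assms by (auto simp: cl_traj_def)

text \<open>With zero thresholds the transmission error itself lies in the sector, so the one-step
  estimate applies with b taken as the weight at the next time. The margin in |x|^2 is discarded: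
  the factor sigma^2 and the terms in z and w suffice for the two claims that follow.\<close>

lemma cl_traj_dissipation:
  assumes ny: "0 < ny"
    and traj: "cl_traj nx nu ny nw nz A B C D K1 K2 Dmin Dmax lam (\<lambda>_. 0) h0 x w yt"
  shows "\<exists>a. (\<forall>k. a k \<in> {0..1}) \<and> (\<forall>k. V (a (Suc k)) (x (Suc k)) + (F *\<^sub>v x k) \<bullet> (F *\<^sub>v x k)
    \<le> \<sigma>\<^sup>2 * V (a k) (x k) + \<gamma>\<^sup>2 * (w k \<bullet> w k))"
proof -
  note c = cl_traj_carrier[OF traj]
  define y where "y k = C *\<^sub>v x k + D *\<^sub>v w k" for k
  have y: "y k \<in> carrier_vec ny" for k using dims c by (simp add: y_def)
  have "\<forall>k. \<exists>a. a \<in> {0..1} \<and> (\<forall>i<ny. \<bar>yt k $ i - y k $ i\<bar> \<le> Del a * lam i * \<bar>y k $ i\<bar>) \<and>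
      x (Suc k) = A *\<^sub>v x k + B *\<^sub>v (Kint a *\<^sub>v yt k)"
  proof
    fix k
    show "\<exists>a. a \<in> {0..1} \<and> (\<forall>i<ny. \<bar>yt k $ i - y k $ i\<bar> \<le> Del a * lam i * \<bar>y k $ i\<bar>) \<and>
        x (Suc k) = A *\<^sub>v x k + B *\<^sub>v (Kint a *\<^sub>v yt k)"
      using cl_traj_step[OF ny _ traj, of k] unfolding y_def add_0_right by blast
  qed
  then obtain a where a: "\<And>k. a k \<in> {0..1}"
    and sec: "\<And>k i. i < ny \<Longrightarrow> \<bar>yt k $ i - y k $ i\<bar> \<le> Del (a k) * lam i * \<bar>y k $ i\<bar>"
    and step: "\<And>k. x (Suc k) = A *\<^sub>v x k + B *\<^sub>v (Kint (a k) *\<^sub>v yt k)" by metis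
  obtain \<epsilon> where "\<epsilon> > 0" and \<epsilon>: "\<And>x w e a b. x \<in> carrier_vec nx \<Longrightarrow> w \<in> carrier_vec nw \<Longrightarrow>
    e \<in> carrier_vec ny \<Longrightarrow> a \<in> {0..1} \<Longrightarrow> b \<in> {0..1} \<Longrightarrow>
    (\<And>i. i < ny \<Longrightarrow> \<bar>e $ i\<bar> \<le> Del a * lam i * \<bar>(C *\<^sub>v x + D *\<^sub>v w) $ i\<bar>) \<Longrightarrow>
    V b (A *\<^sub>v x + B *\<^sub>v (Kint a *\<^sub>v (C *\<^sub>v x + D *\<^sub>v w + e))) + (F *\<^sub>v x) \<bullet> (F *\<^sub>v x) + \<epsilon> * (x \<bullet> x)
      \<le> \<sigma>\<^sup>2 * V a x + \<gamma>\<^sup>2 * (w \<bullet> w)"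
    using dissipation by blast
  have "V (a (Suc k)) (x (Suc k)) + (F *\<^sub>v x k) \<bullet> (F *\<^sub>v x k) \<le> \<sigma>\<^sup>2 * V (a k) (x k) + \<gamma>\<^sup>2 * (w k \<bullet> w k)" for k
  proof -
    let ?e = "yt k - y k"
    have "y k + ?e = yt k" using y[of k] c(3)[of k] by (intro eq_vecI) auto
    then have "x (Suc k) = A *\<^sub>v x k + B *\<^sub>v (Kint (a k) *\<^sub>v (C *\<^sub>v x k + D *\<^sub>v w k + ?e))"
      using step[of k] by (simp add: y_def)
    moreover have "V (a (Suc k)) (A *\<^sub>v x k + B *\<^sub>v (Kint (a k) *\<^sub>v (C *\<^sub>v x k + D *\<^sub>v w k + ?e)))
        + (F *\<^sub>v x k) \<bullet> (F *\<^sub>v x k) + \<epsilon> * (x k \<bullet> x k) \<le> \<sigma>\<^sup>2 * V (a k) (x k) + \<gamma>\<^sup>2 * (w k \<bullet> w k)"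
    proof (rule \<epsilon>[OF c(1) c(2) _ a a])
      show "?e \<in> carrier_vec ny" using y[of k] c(3)[of k] by auto
      show "\<bar>?e $ i\<bar> \<le> Del (a k) * lam i * \<bar>(C *\<^sub>v x k + D *\<^sub>v w k) $ i\<bar>" if "i < ny" for i
        using sec[OF that, of k] y[of k] c(3)[of k] that by (simp add: y_def[symmetric])
    qed
    moreover have "\<epsilon> * (x k \<bullet> x k) \<ge> 0" using \<open>\<epsilon> > 0\<close> scalar_prod_nonneg_real by simp
    ultimately show ?thesis by simp
  qed
  then show ?thesis using a by blast
qed

lemma decay_rate:
  assumes ny: "0 < ny"
  shows "\<exists>Mc \<ge> 1. \<forall>h0 x w yt.
        cl_traj nx nu ny nw nz A B C D K1 K2 Dmin Dmax lam (\<lambda>_. 0) h0 x w yt \<and>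
        (\<forall>k. w k = 0\<^sub>v nw) \<longrightarrow>
        (\<forall>k. enorm (x k) \<le> Mc * \<sigma> ^ k * enorm (x 0))"
proof -
  obtain c1 where c1: "c1 > 0" "\<And>a x. a \<in> {0..1} \<Longrightarrow> x \<in> carrier_vec nx \<Longrightarrow> c1 * (x \<bullet> x) \<le> V a x"
    using V_coercive by blast
  obtain c2 where c2: "c2 > 0" "\<And>a x. a \<in> {0..1} \<Longrightarrow> x \<in> carrier_vec nx \<Longrightarrow> V a x \<le> c2 * (x \<bullet> x)"
    using V_upper by blast
  \<comment> \<open>The root of the ratio of the two norm-equivalence constants of V; the maximum
    with 1 secures \<open>Mc \<ge> 1\<close>.\<close>
  define Mc where "Mc = max 1 (sqrt (c2 / c1))"
  have "enorm (x k) \<le> Mc * \<sigma> ^ k * enorm (x 0)"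
    if traj: "cl_traj nx nu ny nw nz A B C D K1 K2 Dmin Dmax lam (\<lambda>_. 0) h0 x w yt"
      and w: "\<forall>k. w k = 0\<^sub>v nw" for h0 x w yt k
  proof -
    note c = cl_traj_carrier[OF traj]
    from cl_traj_dissipation[OF ny traj] obtain a where a: "\<And>k. a k \<in> {0..1}"
      and diss: "\<And>k. V (a (Suc k)) (x (Suc k)) + (F *\<^sub>v x k) \<bullet> (F *\<^sub>v x k)
        \<le> \<sigma>\<^sup>2 * V (a k) (x k) + \<gamma>\<^sup>2 * (w k \<bullet> w k)" by blast
    have step: "V (a (Suc k)) (x (Suc k)) \<le> \<sigma>\<^sup>2 * V (a k) (x k)" for k
      using diss[of k] w scalar_prod_nonneg_real[of "F *\<^sub>v x k"] by simp
    have "V (a k) (x k) \<le> (\<sigma>\<^sup>2) ^ k * V (a 0) (x 0)" for k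
    proof (induction k)
      case (Suc k)
      have "V (a (Suc k)) (x (Suc k)) \<le> \<sigma>\<^sup>2 * V (a k) (x k)" by (rule step)
      also have "\<dots> \<le> \<sigma>\<^sup>2 * ((\<sigma>\<^sup>2) ^ k * V (a 0) (x 0))" by (intro mult_left_mono Suc.IH) simp
      finally show ?case by (simp add: mult.assoc)
    qed simp
    then have "c1 * (x k \<bullet> x k) \<le> (\<sigma>\<^sup>2) ^ k * V (a 0) (x 0)"
      using c1(2)[OF a c(1)] order_trans by blast
    also have "\<dots> \<le> (\<sigma>\<^sup>2) ^ k * (c2 * (x 0 \<bullet> x 0))"
      by (intro mult_left_mono c2(2) a c) simp
    finally have "x k \<bullet> x k \<le> c2 / c1 * (\<sigma> ^ k)\<^sup>2 * (x 0 \<bullet> x 0)"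
      using c1(1) by (simp add: field_simps power_mult[symmetric] mult.commute)
    then have "enorm (x k) \<le> sqrt (c2 / c1 * (\<sigma> ^ k)\<^sup>2 * (x 0 \<bullet> x 0))"
      unfolding enorm_def by simp
    also have "\<dots> = sqrt (c2 / c1) * \<sigma> ^ k * enorm (x 0)"
      unfolding real_sqrt_mult enorm_def real_sqrt_abs using sigma by simp
    also have "\<dots> \<le> Mc * \<sigma> ^ k * enorm (x 0)"
      using sigma by (intro mult_right_mono) (auto simp: Mc_def enorm_def scalar_prod_nonneg_real)
    finally show ?thesis .
  qed
  then show ?thesis by (intro exI[of _ Mc]) (auto simp: Mc_def)
qed

lemma l2_gain:
  assumes ny: "0 < ny" and \<gamma>: "0 < \<gamma>"
    and traj: "cl_traj nx nu ny nw nz A B C D K1 K2 Dmin Dmax lam (\<lambda>_. 0) h0 x w yt"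
    and x0: "x 0 = 0\<^sub>v nx" and w: "summable (\<lambda>k. w k \<bullet> w k)"
  shows "summable (\<lambda>k. (F *\<^sub>v x k) \<bullet> (F *\<^sub>v x k)) \<and>
    sqrt (\<Sum>k. (F *\<^sub>v x k) \<bullet> (F *\<^sub>v x k)) \<le> \<gamma> * sqrt (\<Sum>k. w k \<bullet> w k)"
proof -
  note c = cl_traj_carrier[OF traj]
  let ?z = "\<lambda>k. (F *\<^sub>v x k) \<bullet> (F *\<^sub>v x k)" and ?w = "\<lambda>k. w k \<bullet> w k"
  from cl_traj_dissipation[OF ny traj] obtain a where a: "\<And>k. a k \<in> {0..1}"
    and diss: "\<And>k. V (a (Suc k)) (x (Suc k)) + ?z k \<le> \<sigma>\<^sup>2 * V (a k) (x k) + \<gamma>\<^sup>2 * ?w k" by blast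
  \<comment> \<open>Relaxing the factor to 1 makes the storage terms telescope; the initial one
    vanishes with x 0 and the final one is nonnegative.\<close>
  have "\<sigma>\<^sup>2 \<le> 1" using sigma by (simp add: power_le_one)
  then have step: "V (a (Suc k)) (x (Suc k)) + ?z k \<le> V (a k) (x k) + \<gamma>\<^sup>2 * ?w k" for k
    using diss[of k] mult_right_mono[OF _ V_nonneg[OF a c(1)], of "\<sigma>\<^sup>2" 1 k k] by simp
  have V0: "V (a 0) (x 0) = 0"
    unfolding V_def x0 using P_carrier[of 1] P_carrier[of 2] by (simp add: scalar_prod_def)
  have "V (a n) (x n) + (\<Sum>k<n. ?z k) \<le> \<gamma>\<^sup>2 * (\<Sum>k<n. ?w k)" for n
  proof (induction n)
    case (Suc n)
    then show ?case using step[of n] by (simp add: distrib_left)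
  qed (simp add: V0)
  then have "(\<Sum>k<n. ?z k) \<le> \<gamma>\<^sup>2 * (\<Sum>k<n. ?w k)" for n
    using V_nonneg[OF a c(1), of n n] by (smt (verit))
  moreover have "\<gamma>\<^sup>2 * (\<Sum>k<n. ?w k) \<le> \<gamma>\<^sup>2 * suminf ?w" for n
    by (intro mult_left_mono sum_le_suminf w) (auto simp: scalar_prod_nonneg_real)
  ultimately have bound: "(\<Sum>k<n. ?z k) \<le> \<gamma>\<^sup>2 * suminf ?w" for n
    using order_trans by blast
  have z: "summable ?z"
    by (rule summableI_nonneg_bounded[OF _ bound]) (simp add: scalar_prod_nonneg_real)
  have "suminf ?z \<le> \<gamma>\<^sup>2 * suminf ?w"
    by (rule suminf_le_const[OF z bound])
  then have "sqrt (suminf ?z) \<le> sqrt (\<gamma>\<^sup>2 * suminf ?w)" by simp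
  then show ?thesis using z \<gamma> by (simp add: real_sqrt_mult)
qed

section \<open>Ultimate bound under bounded noise and positive thresholds\<close>

lemma practical_stability:
  assumes ny: "0 < ny" and del: "\<And>i. i < ny \<Longrightarrow> 0 \<le> del i"
  shows "\<exists>rho \<ge> 0. \<forall>wbar \<ge> 0. \<forall>h0 x w yt.
        cl_traj nx nu ny nw nz A B C D K1 K2 Dmin Dmax lam del h0 x w yt \<and>
        (\<forall>k. inorm (w k) \<le> wbar) \<longrightarrow>
        limsup (\<lambda>k. ereal (enorm (x k))) \<le>
          ereal (rho * Max ((\<lambda>i. (Dmax * lam i + 1) * wbar * inorm_mat D + del i) ` {..<ny}))"
proof -
  obtain c1 where c1: "c1 > 0" "\<And>a x. a \<in> {0..1} \<Longrightarrow> x \<in> carrier_vec nx \<Longrightarrow> c1 * (x \<bullet> x) \<le> V a x"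
    using V_coercive by blast
  obtain c2 where c2: "c2 > 0" "\<And>a x. a \<in> {0..1} \<Longrightarrow> x \<in> carrier_vec nx \<Longrightarrow> V a x \<le> c2 * (x \<bullet> x)"
    using V_upper by blast
  have BK: "B * K1 \<in> carrier_mat nx ny" "B * K2 \<in> carrier_mat nx ny" using dims by auto
  obtain b1 where b1: "b1 \<ge> 0" "\<And>v. v \<in> carrier_vec ny \<Longrightarrow>
      ((B * K1) *\<^sub>v v) \<bullet> ((B * K1) *\<^sub>v v) \<le> b1 * (v \<bullet> v)"
    using mult_mat_vec_sq_le[OF BK(1)] by blast
  obtain b2 where b2: "b2 \<ge> 0" "\<And>v. v \<in> carrier_vec ny \<Longrightarrow>
      ((B * K2) *\<^sub>v v) \<bullet> ((B * K2) *\<^sub>v v) \<le> b2 * (v \<bullet> v)"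
    using mult_mat_vec_sq_le[OF BK(2)] by blast
  \<comment> \<open>Each factor 2 comes from splitting the gain into its two vertices by the Young
    inequality with t = 1; c2 then passes from V to the squared norm.\<close>
  define b where "b = c2 * (2 * b1 + 2 * b2)"
  have b: "b \<ge> 0" using b1 b2 c2 by (simp add: b_def)
  have V_input: "V a' (B *\<^sub>v (Kint a *\<^sub>v v)) \<le> b * (v \<bullet> v)"
    if a: "a \<in> {0..1}" "a' \<in> {0..1}" and v: "v \<in> carrier_vec ny" for a a' v
  proof -
    define u1 where "u1 = (B * K1) *\<^sub>v v"
    define u2 where "u2 = (B * K2) *\<^sub>v v"
    have u: "u1 \<in> carrier_vec nx" "u2 \<in> carrier_vec nx" unfolding u1_def u2_def by (rule mult_mat_vec_carrier[OF BK(1) v] mult_mat_vec_carrier[OF BK(2) v])+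
    have eq: "B *\<^sub>v (Kint a *\<^sub>v v) = (1 - a) \<cdot>\<^sub>v u1 + a \<cdot>\<^sub>v u2"
      unfolding u1_def u2_def using dims v
      by (simp add: Kint_mult_vec mult_add_distrib_mat_vec[of _ nx nu] mult_mat_vec[of _ nx nu]
          assoc_mult_mat_vec[of _ nx nu _ ny])
    \<comment> \<open>The weights 1 - a and a lie in [0, 1], so scaling by them cannot increase V.
      This makes the bound uniform in a.\<close>
    have V_smult: "V a' (s \<cdot>\<^sub>v z) \<le> V a' z" if s: "s \<in> {0..1}" and z: "z \<in> carrier_vec nx" for s z
    proof -
      have "(s \<cdot>\<^sub>v z) \<bullet> (P p *\<^sub>v (s \<cdot>\<^sub>v z)) = s * s * (z \<bullet> (P p *\<^sub>v z))" if "p \<in> {1, 2}" for p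
        using z P_carrier[OF that] by (simp add: mult_mat_vec[of _ nx nx])
      then have "V a' (s \<cdot>\<^sub>v z) = (s * s) * V a' z"
        by (simp add: V_def algebra_simps)
      also have "\<dots> \<le> 1 * V a' z"
        using s by (intro mult_right_mono V_nonneg a z) (auto simp: mult_le_one)
      finally show ?thesis by simp
    qed
    have "V a' (B *\<^sub>v (Kint a *\<^sub>v v)) \<le> 2 * V a' ((1 - a) \<cdot>\<^sub>v u1) + 2 * V a' (a \<cdot>\<^sub>v u2)"
      unfolding eq using V_young[OF a(2), of "(1 - a) \<cdot>\<^sub>v u1" "a \<cdot>\<^sub>v u2" 1] u by simp
    also have "\<dots> \<le> 2 * V a' u1 + 2 * V a' u2"
      using a u by (intro add_mono mult_left_mono V_smult) auto
    also have "\<dots> \<le> 2 * (c2 * (b1 * (v \<bullet> v))) + 2 * (c2 * (b2 * (v \<bullet> v)))"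
      using c2(1) u v unfolding u1_def u2_def
      by (intro add_mono mult_left_mono order_trans[OF c2(2)[OF a(2)]] b1 b2) auto
    also have "\<dots> = b * (v \<bullet> v)" by (simp add: b_def algebra_simps)
    finally show ?thesis .
  qed
  obtain \<epsilon> where "\<epsilon> > 0" and \<epsilon>: "\<And>x w e a b. x \<in> carrier_vec nx \<Longrightarrow> w \<in> carrier_vec nw \<Longrightarrow>
    e \<in> carrier_vec ny \<Longrightarrow> a \<in> {0..1} \<Longrightarrow> b \<in> {0..1} \<Longrightarrow>
    (\<And>i. i < ny \<Longrightarrow> \<bar>e $ i\<bar> \<le> Del a * lam i * \<bar>(C *\<^sub>v x + D *\<^sub>v w) $ i\<bar>) \<Longrightarrow>
    V b (A *\<^sub>v x + B *\<^sub>v (Kint a *\<^sub>v (C *\<^sub>v x + D *\<^sub>v w + e))) + (F *\<^sub>v x) \<bullet> (F *\<^sub>v x) + \<epsilon> * (x \<bullet> x)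
      \<le> \<sigma>\<^sup>2 * V a x + \<gamma>\<^sup>2 * (w \<bullet> w)"
    using dissipation by blast
  \<comment> \<open>The choice t <= \<epsilon> / (2 c2) turns the margin into a contraction by 1 -
    2t. Half of it is spent on the disturbance, as (1 + t)(1 - 2t) <= 1 - t. The cap 1/2 keeps 1 - t
    nonnegative.\<close>
  define t where "t = min (1 / 2) (\<epsilon> / (2 * c2))"
  have t: "0 < t" "t \<le> 1 / 2" "2 * t \<le> \<epsilon> / c2" using \<open>\<epsilon> > 0\<close> c2(1) by (auto simp: t_def min_def field_simps)
  \<comment> \<open>The large Young factor times the gain from input disturbance to V;
    \<open>ny\<close> enters through v . v <= ny d^2.\<close>
  define \<beta> where "\<beta> = (1 + 1 / t) * (b * ny)"
  have \<beta>: "\<beta> \<ge> 0" using t b by (simp add: \<beta>_def)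
  \<comment> \<open>The recursion V' <= (1 - t) V + \<beta> d^2 has fixed point \<beta> d^2 / t;
    dividing by c1 and taking the root gives rho d. No constant here involves wbar or the
    trajectory.\<close>
  define rho where "rho = sqrt (\<beta> / (t * c1))"
  have "limsup (\<lambda>k. ereal (enorm (x k))) \<le>
      ereal (rho * Max ((\<lambda>i. (Dmax * lam i + 1) * wbar * inorm_mat D + del i) ` {..<ny}))"
    if wbar: "wbar \<ge> 0" "\<forall>k. inorm (w k) \<le> wbar"
      and traj: "cl_traj nx nu ny nw nz A B C D K1 K2 Dmin Dmax lam del h0 x w yt" for wbar h0 x w yt
  proof -
    define r where "r i = (Dmax * lam i + 1) * wbar * inorm_mat D + del i" for i
    define d where "d = Max (r ` {..<ny})"
    have r_le: "r i \<le> d" if "i < ny" for i unfolding d_def using that by (intro Max_ge) auto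
    have r_nonneg: "0 \<le> r i" if "i < ny" for i
      unfolding r_def using Delta lam_pos[OF that] del[OF that] wbar inorm_mat_nonneg[OF dims(4)]
      by (intro add_nonneg_nonneg mult_nonneg_nonneg) auto
    have d: "d \<ge> 0" using r_le[OF ny] r_nonneg[OF ny] by linarith
    note c = cl_traj_carrier[OF traj]
    have "\<forall>k. \<exists>a. a \<in> {0..1} \<and> (\<forall>i<ny. \<bar>yt k $ i - (C *\<^sub>v x k + D *\<^sub>v w k) $ i\<bar>
          \<le> Del a * lam i * \<bar>(C *\<^sub>v x k + D *\<^sub>v w k) $ i\<bar> + del i) \<and>
        x (Suc k) = A *\<^sub>v x k + B *\<^sub>v (Kint a *\<^sub>v yt k)"
      using cl_traj_step[OF ny del traj] by blast
    then obtain a where a: "\<And>k. a k \<in> {0..1}"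
      and sec: "\<And>k i. i < ny \<Longrightarrow> \<bar>yt k $ i - (C *\<^sub>v x k + D *\<^sub>v w k) $ i\<bar>
          \<le> Del (a k) * lam i * \<bar>(C *\<^sub>v x k + D *\<^sub>v w k) $ i\<bar> + del i"
      and step: "\<And>k. x (Suc k) = A *\<^sub>v x k + B *\<^sub>v (Kint (a k) *\<^sub>v yt k)" by metis
    \<comment> \<open>Measured against the noise-free output \<open>C x\<close>, the held value violates the sector condition
      by at most \<open>d\<close>; clipping moves this excess into an additive input disturbance.\<close>
    have V_step: "V (a (Suc k)) (x (Suc k)) \<le> (1 - t) * V (a k) (x k) + \<beta> * d\<^sup>2" for k
    proof -
      define f where "f i = Del (a k) * lam i * \<bar>(C *\<^sub>v x k) $ i\<bar>" for i
      define e where "e = vec ny (\<lambda>i. max (- f i) (min (f i) (yt k $ i - (C *\<^sub>v x k) $ i)))"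
      define v where "v = yt k - C *\<^sub>v x k - e"
      have Cx: "C *\<^sub>v x k \<in> carrier_vec ny" and Dw: "D *\<^sub>v w k \<in> carrier_vec ny"
        using dims c[of k] by auto
      have e: "e \<in> carrier_vec ny" by (simp add: e_def)
      have v: "v \<in> carrier_vec ny" using c(3)[of k] Cx e by (simp add: v_def)
      have f: "0 \<le> f i" if "i < ny" for i
        using Del_nonneg[OF a, of k] lam_pos[OF that] by (simp add: f_def)
      \<comment> \<open>Noise enters twice: once when y is replaced by C x inside the error, which
        gives the summand 1, and once inside the sector bound, which gives Dmax lam_i.\<close>
      have excess: "\<bar>yt k $ i - (C *\<^sub>v x k) $ i\<bar> \<le> f i + d" if i: "i < ny" for i
      proof -
        let ?l = "Del (a k) * lam i" and ?Cx = "(C *\<^sub>v x k) $ i" and ?Dw = "(D *\<^sub>v w k) $ i"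
        have l: "0 \<le> ?l" "?l \<le> Dmax * lam i"
          using Del_nonneg[OF a, of k] Del_le[OF a, of k] lam_pos[OF i] by auto
        have Dwi: "\<bar>?Dw\<bar> \<le> wbar * inorm_mat D"
          using mult_mat_vec_index_le_inorm[OF dims(4) c(2)[of k] _ i] wbar by simp
        have "\<bar>yt k $ i - (?Cx + ?Dw)\<bar> \<le> ?l * \<bar>?Cx + ?Dw\<bar> + del i"
        proof -
          have "(C *\<^sub>v x k + D *\<^sub>v w k) $ i = ?Cx + ?Dw"
            by (rule index_add_vec(1)) (simp only: carrier_vecD[OF Dw] i)
          then show ?thesis using sec[OF i, of k] by (simp only:)
        qed
        moreover have "?l * \<bar>?Cx + ?Dw\<bar> \<le> ?l * (\<bar>?Cx\<bar> + \<bar>?Dw\<bar>)"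
          using l by (intro mult_left_mono) auto
        moreover have "?l * \<bar>?Dw\<bar> \<le> Dmax * lam i * (wbar * inorm_mat D)"
          by (rule mult_mono[OF l(2) Dwi order_trans[OF l] abs_ge_zero])
        ultimately have "\<bar>yt k $ i - ?Cx\<bar> \<le> ?l * \<bar>?Cx\<bar> + (Dmax * lam i * (wbar * inorm_mat D) + wbar * inorm_mat D + del i)"
          using Dwi by (simp add: distrib_left)
        then show ?thesis using r_le[OF i] by (simp add: f_def r_def algebra_simps)
      qed
      have vi: "\<bar>v $ i\<bar> \<le> d" if i: "i < ny" for i
      proof -
        have "v $ i = yt k $ i - (C *\<^sub>v x k) $ i - e $ i" using i c(3)[of k] dims(3) e by (simp add: v_def)
        moreover have "e $ i = max (- f i) (min (f i) (yt k $ i - (C *\<^sub>v x k) $ i))"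
          using i by (simp add: e_def)
        ultimately show ?thesis using excess[OF i] f[OF i] d by linarith
      qed
      have "v \<bullet> v = (\<Sum>i<ny. (v $ i)\<^sup>2)"
        using v by (simp add: scalar_prod_def power2_eq_square atLeast0LessThan)
      also have "\<dots> \<le> (\<Sum>i<ny. d\<^sup>2)"
        using vi d by (intro sum_mono) (metis abs_of_nonneg abs_le_square_iff lessThan_iff)
      finally have vv: "v \<bullet> v \<le> ny * d\<^sup>2" by simp
      \<comment> \<open>The successor that clipped error and zero noise would produce. The vanishing
        term in D is written out so that the dissipation inequality matches literally.\<close>
      define xh where "xh = A *\<^sub>v x k + B *\<^sub>v (Kint (a k) *\<^sub>v (C *\<^sub>v x k + D *\<^sub>v 0\<^sub>v nw + e))"
      have Cx0: "C *\<^sub>v x k + D *\<^sub>v 0\<^sub>v nw = C *\<^sub>v x k"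
        using dims by (intro eq_vecI) auto
      have xh: "xh \<in> carrier_vec nx" unfolding xh_def using dims by (intro carrier_vecI) auto
      have Bv: "B *\<^sub>v (Kint (a k) *\<^sub>v v) \<in> carrier_vec nx" using dims by (intro carrier_vecI) auto
      have x_eq: "x (Suc k) = xh + B *\<^sub>v (Kint (a k) *\<^sub>v v)"
      proof -
        have "yt k = (C *\<^sub>v x k + e) + v"
          using c(3)[of k] dims(3) e by (intro eq_vecI) (auto simp: v_def)
        then have "B *\<^sub>v (Kint (a k) *\<^sub>v yt k) = B *\<^sub>v (Kint (a k) *\<^sub>v (C *\<^sub>v x k + e)) + B *\<^sub>v (Kint (a k) *\<^sub>v v)"
          using Kint_carrier[of "a k"] dims(2) v add_carrier_vec[OF Cx e]
          by (simp add: mult_add_distrib_mat_vec[OF Kint_carrier _ v] mult_add_distrib_mat_vec[of _ nx nu]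
              del: assoc_add_vec)
        moreover have "A *\<^sub>v x k \<in> carrier_vec nx" "B *\<^sub>v (Kint (a k) *\<^sub>v (C *\<^sub>v x k + e)) \<in> carrier_vec nx"
          using dims by (auto intro!: carrier_vecI)
        ultimately show ?thesis
          unfolding step[of k] xh_def Cx0 using Bv by (simp add: assoc_add_vec[of _ nx])
      qed
      have "\<bar>e $ i\<bar> \<le> Del (a k) * lam i * \<bar>(C *\<^sub>v x k + D *\<^sub>v 0\<^sub>v nw) $ i\<bar>" if "i < ny" for i
        unfolding Cx0 f_def[symmetric] using f[OF that] that by (auto simp: e_def)
      from \<epsilon>[OF c(1) zero_carrier_vec e a a[of "Suc k"] this]
      have "V (a (Suc k)) xh + \<epsilon> * (x k \<bullet> x k) \<le> \<sigma>\<^sup>2 * V (a k) (x k)"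
        using scalar_prod_nonneg_real[of "F *\<^sub>v x k"] by (simp add: xh_def)
      moreover have "\<sigma>\<^sup>2 * V (a k) (x k) \<le> 1 * V (a k) (x k)"
        using sigma by (intro mult_right_mono V_nonneg a c) (simp add: power_le_one)
      \<comment> \<open>The upper bound on V converts the margin in |x|^2 into a fraction of
        V.\<close>
      moreover have "2 * t * V (a k) (x k) \<le> \<epsilon> * (x k \<bullet> x k)"
      proof -
        have "2 * t * V (a k) (x k) \<le> \<epsilon> / c2 * (c2 * (x k \<bullet> x k))"
          using t \<open>\<epsilon> > 0\<close> c2(1) by (intro mult_mono c2(2) a c V_nonneg) auto
        then show ?thesis using c2(1) by simp
      qed
      ultimately have "V (a (Suc k)) xh \<le> (1 - 2 * t) * V (a k) (x k)"
        by (simp add: algebra_simps)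
      then have "(1 + t) * V (a (Suc k)) xh \<le> (1 + t) * ((1 - 2 * t) * V (a k) (x k))"
        using t by (intro mult_left_mono) auto
      also have "\<dots> = (1 - t) * V (a k) (x k) - 2 * (t * t) * V (a k) (x k)"
        by (simp add: algebra_simps)
      also have "\<dots> \<le> (1 - t) * V (a k) (x k)"
        using t V_nonneg[OF a c(1), of k k] by simp
      finally have xh_le: "(1 + t) * V (a (Suc k)) xh \<le> (1 - t) * V (a k) (x k)" .
      have "V (a (Suc k)) (B *\<^sub>v (Kint (a k) *\<^sub>v v)) \<le> b * (ny * d\<^sup>2)"
        by (rule order_trans[OF V_input[OF a a v] mult_left_mono[OF vv b]])
      then have "(1 + 1 / t) * V (a (Suc k)) (B *\<^sub>v (Kint (a k) *\<^sub>v v)) \<le> (1 + 1 / t) * (b * (ny * d\<^sup>2))"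
        using t by (intro mult_left_mono) auto
      also have "\<dots> = \<beta> * d\<^sup>2" by (simp add: \<beta>_def)
      finally show ?thesis
        using V_young[OF a[of "Suc k"] xh Bv t(1)] xh_le unfolding x_eq by linarith
    qed
    have V_le: "V (a k) (x k) \<le> (1 - t) ^ k * V (a 0) (x 0) + \<beta> * d\<^sup>2 / t" for k
    proof (induction k)
      case 0
      then show ?case using \<beta> t by simp
    next
      case (Suc k)
      have "V (a (Suc k)) (x (Suc k)) \<le> (1 - t) * V (a k) (x k) + \<beta> * d\<^sup>2" by (rule V_step)
      also have "\<dots> \<le> (1 - t) * ((1 - t) ^ k * V (a 0) (x 0) + \<beta> * d\<^sup>2 / t) + \<beta> * d\<^sup>2"
        using t by (intro add_right_mono mult_left_mono Suc.IH) auto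
      also have "\<dots> = (1 - t) ^ Suc k * V (a 0) (x 0) + \<beta> * d\<^sup>2 / t"
        using t by (simp add: field_simps)
      finally show ?case .
    qed
    \<comment> \<open>Only the geometric term carries the initial state; it dies out in the limit,
      which leaves an ultimate bound independent of x 0 and h0.\<close>
    let ?g = "\<lambda>k. sqrt (((1 - t) ^ k * V (a 0) (x 0) + \<beta> * d\<^sup>2 / t) / c1)"
    have x_le: "enorm (x k) \<le> ?g k" for k
      unfolding enorm_def using order_trans[OF c1(2)[OF a c(1)] V_le, of k] c1(1)
      by (simp add: field_simps)
    have pow: "(\<lambda>k. (1 - t) ^ k) \<longlonglongrightarrow> 0" using t by (intro LIMSEQ_power_zero) simp
    have "?g \<longlonglongrightarrow> sqrt ((0 * V (a 0) (x 0) + \<beta> * d\<^sup>2 / t) / c1)"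
      using c1(1) by (intro tendsto_real_sqrt tendsto_divide tendsto_add tendsto_mult pow tendsto_const) simp
    moreover have "sqrt ((0 * V (a 0) (x 0) + \<beta> * d\<^sup>2 / t) / c1) = rho * d"
    proof -
      have "(0 * V (a 0) (x 0) + \<beta> * d\<^sup>2 / t) / c1 = \<beta> / (t * c1) * d\<^sup>2" by simp
      then show ?thesis unfolding rho_def using d by (simp only: real_sqrt_mult real_sqrt_abs abs_of_nonneg)
    qed
    ultimately have "limsup (\<lambda>k. ereal (?g k)) = ereal (rho * d)"
      by (intro lim_imp_Limsup) auto
    moreover have "limsup (\<lambda>k. ereal (enorm (x k))) \<le> limsup (\<lambda>k. ereal (?g k))"
      by (rule Limsup_mono) (use x_le in auto)
    ultimately show ?thesis unfolding d_def r_def by simp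
  qed
  moreover have "rho \<ge> 0" using \<beta> t c1(1) by (simp add: rho_def)
  ultimately show ?thesis by blast
qed

end

theorem theorem1:
  fixes nx nu ny nw nz :: nat
    and A B C D F K1 K2 :: "real mat"
    and Dmin Dmax sigma gamma :: real
    and lam del :: "nat \<Rightarrow> real"
    and P :: "nat \<Rightarrow> real mat"
    and L M N Z :: "nat \<Rightarrow> real vec \<Rightarrow> real mat"
  assumes ny_pos: "0 < ny"
    and dims: "A \<in> carrier_mat nx nx" "B \<in> carrier_mat nx nu" "C \<in> carrier_mat ny nx"
      "D \<in> carrier_mat ny nw" "F \<in> carrier_mat nz nx"
      "K1 \<in> carrier_mat nu ny" "K2 \<in> carrier_mat nu ny"
    and Delta: "0 \<le> Dmin" "Dmin < Dmax"
    and lam_pos: "\<And>i. i < ny \<Longrightarrow> 0 < lam i"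
    and del_nonneg: "\<And>i. i < ny \<Longrightarrow> 0 \<le> del i"
    and sigma: "0 < sigma" "sigma \<le> 1"
    and gamma: "0 < gamma"
    and P_pd: "\<And>p. p \<in> {1, 2} \<Longrightarrow> pd_mat nx (P p)"
    and LMN: "\<And>p j. p \<in> {1, 2} \<Longrightarrow> j \<in> J_set ny \<Longrightarrow>
        L p j \<in> carrier_mat ny ny \<and> M p j \<in> carrier_mat ny ny \<and> N p j \<in> carrier_mat ny ny \<and>
        sym_mat (2 * ny) (four_block_mat (L p j) (N p j) (transpose_mat (N p j)) (M p j)) \<and>
        nonneg_entries (four_block_mat (L p j) (N p j) (transpose_mat (N p j)) (M p j))"
    and Z_sym: "\<And>p j. p \<in> {1, 2} \<Longrightarrow> j \<in> J_set ny \<Longrightarrow> sym_mat ny (Z p j)"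
    and LMI: "\<And>p q j. p \<in> {1, 2} \<Longrightarrow> q \<in> {1, 2} \<Longrightarrow> j \<in> J_set ny \<Longrightarrow>
        pd_mat ((nx + nw + ny) + (nx + nz + 2 * ny))
          (LMI_mat nx nu ny nw nz A B C D F sigma gamma (P p) (P q)
             (if p = 1 then K1 else K2) (if p = 1 then Dmin else Dmax) (Lam_mat ny lam j)
             (L q j) (M q j) (N q j) (Z q j))"
  shows
    "(\<exists>rho \<ge> 0. \<forall>wbar \<ge> 0. \<forall>h0 x w yt.
        cl_traj nx nu ny nw nz A B C D K1 K2 Dmin Dmax lam del h0 x w yt \<and>
        (\<forall>k. inorm (w k) \<le> wbar) \<longrightarrow>
        limsup (\<lambda>k. ereal (enorm (x k))) \<le>
          ereal (rho * Max ((\<lambda>i. (Dmax * lam i + 1) * wbar * inorm_mat D + del i) ` {..<ny})))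
     \<and> (\<exists>Mc \<ge> 1. \<forall>h0 x w yt.
        cl_traj nx nu ny nw nz A B C D K1 K2 Dmin Dmax lam (\<lambda>_. 0) h0 x w yt \<and>
        (\<forall>k. w k = 0\<^sub>v nw) \<longrightarrow>
        (\<forall>k. enorm (x k) \<le> Mc * sigma ^ k * enorm (x 0)))
     \<and> (\<forall>h0 x w yt.
        cl_traj nx nu ny nw nz A B C D K1 K2 Dmin Dmax lam (\<lambda>_. 0) h0 x w yt \<and>
        x 0 = 0\<^sub>v nx \<and> summable (\<lambda>k. w k \<bullet> w k) \<longrightarrow>
        summable (\<lambda>k. (F *\<^sub>v x k) \<bullet> (F *\<^sub>v x k)) \<and>
        sqrt (\<Sum>k. (F *\<^sub>v x k) \<bullet> (F *\<^sub>v x k)) \<le> gamma * sqrt (\<Sum>k. w k \<bullet> w k))"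
proof -
  interpret etod_lmi nx nu ny nw nz A B C D F K1 K2 Dmin Dmax sigma gamma lam P L M N Z
    by (rule etod_lmi.intro) (fact assms)+
  show ?thesis
    by (rule conjI[OF practical_stability[OF ny_pos del_nonneg] conjI[OF decay_rate[OF ny_pos]]])
      (assumption | intro allI impI | elim conjE | rule l2_gain[OF ny_pos gamma])+
qed

end
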